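(* Consider the undisturbed system $x[n+1]=f(x[n],u[n])$, in the difference-of-convex form described in the context, controlled by the successive linearization tube-based MPC algorithm described in the context. Then $x=x^r$ is an asymptotically stable equilibrium of the closed-loop system, with region of attraction equal to the set of initial states $x[0]$ for which a feasible initial trajectory $(\mathbf{x}^\circ,\mathbf{u}^\circ)$ with $x_0^\circ=x[0]$ exists.
   Context: **System and constraints.** $f:\mathbb{R}^{n_x}\times\mathbb{R}^{n_u}\to\mathbb{R}^{n_x}$ is differentiable. $\mathcal{X}\subset\mathbb{R}^{n_x}$ and $\mathcal{U}\subset\mathbb{R}^{n_u}$ are compact convex sets. $(x^r,u^r)$ is a constant reference. $Q\succ0$, $R\succ0$, $\hat Q\succ0$ are weighting matrices, and $\lVert x\rVert_P=(x^\top Px)^{1/2}$. $N\ge1$ is the horizon. **Terminal parameters.** $\hat K$, $\hat Q\succ 0$, $\hat\gamma>0$ and $\hat{\mathcal{X}}=\{x:\lVert x-x^r\rVert_{\hat Q}^2\le\hat\gamma\}$ are such that $\hat{\mathcal{X}}\subseteq\mathcal{X}$, $\hat K(x-x^r)+u^r\in\mathcal{U}$ for all $x\in\hat{\mathcal{X}}$, and for all $x\in\hat{\mathcal{X}}$ $$\lVert x-x^r\rVert_{\hat Q}^2\ge\lVert f(x,\hat K(x-x^r)+u^r)-x^r\rVert_{\hat Q}^2+\lVert x-x^r\rVert_Q^2+\lVert\hat K(x-x^r)\rVert_R^2 .$$ **Tube.** A tube is $\boldsymbol{\mathcal{X}}=\{\mathcal{X}_k\}_{k=0}^N$ with polytopic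 cross sections $\mathcal{X}_k=\{x:\Gamma x\le q_k\}$ and vertex set $\mathcal{V}(\mathcal{X}_k)$, in one of two parameterizations. (i) Elementwise bounds: $\Gamma=[I\ \ {-I}]^\top$, $q_k=[q_{2,k}^\top\ \ {-q_{1,k}^\top}]^\top$ with $q_{1,k},q_{2,k}\in\mathbb{R}^{n_x}$, and $\mathcal{V}(\mathcal{X}_k)$ consists of the $2^{n_x}$ points $\hat x$ with each $[\hat x]_l\in\{[q_{1,k}]_l,[q_{2,k}]_l\}$. (ii) Simplex: $\Gamma=[-I\ \ \mathbf 1]^\top$ ($\mathbf 1$ the vector of ones), $q_k=[\alpha_k^\top\ \ \beta_k]^\top$ with $\alpha_k\in\mathbb{R}^{n_x}$, $\beta_k\in\mathbb{R}$, $\sigma_k=\beta_k+\mathbf 1^\top\alpha_k$, and $\mathcal{V}(\mathcal{X}_k)=\{-\alpha_k,-\alpha_k+e_1\sigma_k,\dots,-\alpha_k+e_{n_x}\sigma_k\}$. Degenerate cross sections (single points) are allowed. **DC form.** $\Gamma f=g-h$, where all components of $g,h$ are convex functions of $(x,u)$ and $h$ is differentiable. Given a trajectory $(\mathbf{x}^\circ,\mathbf{u}^\circ)$, $\lfloor h^\circ\rfloor(x,u)$ denotes, at prediction step $k$, the first-order Taylor expansion of $h$ at $(x_k^\circ,u_k^\circ)$. **Feasible trajectory.** $(\mathbf{x}^\circ,\mathbf{u}^\circ)=(\{x_k^\circ\}_{k=0}^N,\{u_k^\circ\}_{k=0}^{N-1})$ with $x_{k+1}^\circ=f(x_k^\circ,u_k^\circ)$,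 $(x_k^\circ,u_k^\circ)\in\mathcal{X}\times\mathcal{U}$ for $k=0,\dots,N-1$, and $\lVert x_N^\circ-x^r\rVert_{\hat Q}^2\le\hat\gamma$. **Problem (P)** (given $(\mathbf{x}^\circ,\mathbf{u}^\circ)$ and gains $\{K_k\}_{k=0}^{N-1}$): minimize $\theta_N^2+\sum_{k=0}^{N-1}(\theta_k^2+\chi_k^2)$ over $\mathbf{v}=\{v_k\}_{k=0}^{N-1}$, the tube ($q_k$ and vertices $\mathcal{V}(\mathcal{X}_k)$, $k=0,\dots,N$), $\theta_k$ and $\chi_k$, subject to, for all $k\in\{0,\dots,N-1\}$ and all $\hat x_k\in\mathcal{V}(\mathcal{X}_k)$: $\lVert\hat x_k-x^r\rVert_Q\le\theta_k$; $\lVert v_k+K_k\hat x_k-u^r\rVert_R\le\chi_k$; $g(\hat x_k,v_k+K_k\hat x_k)-\lfloor h^\circ\rfloor(\hat x_k,v_k+K_k\hat x_k)\le q_{k+1}$ (componentwise); $\hat x_k\in\mathcal{X}$; $v_k+K_k\hat x_k\in\mathcal{U}$; and $\lVert\hat x_N-x^r\rVert_{\hat Q}\le\theta_N\le\sqrt{\hat\gamma}$ for all $\hat x_N\in\mathcal{V}(\mathcal{X}_N)$; and all vertices $\hat x_0$ of the initial cross section equal $x_0^\circ$. **Gains.** With $A_k=\frac{\partial f}{\partial x}(x_k^\circ,u_k^\circ)$, $B_k=\frac{\partial f}{\partial u}(x_k^\circ,u_k^\circ)$ and $P_N=\hat Q$, for $k=N-1,\dots,0$: $\Delta_k=B_k^\top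 P_{k+1}B_k+R$, $K_k=-\Delta_k^{-1}B_k^\top P_{k+1}A_k$, $P_k=Q+A_k^\top P_{k+1}A_k-A_k^\top P_{k+1}B_k\Delta_k^{-1}B_k^\top P_{k+1}A_k$. **Algorithm.** At each time $n=0,1,\dots$: 1. Set $x_0^\circ\leftarrow x[n]$. If $n=0$, find a feasible trajectory $(\mathbf{x}^\circ,\mathbf{u}^\circ)$ starting at $x_0^\circ$. If $n>0$, shift the last trajectory of time $n-1$: $u_k^\circ\leftarrow u_{k+1}^\circ$ and $x_{k+1}^\circ\leftarrow f(x_k^\circ,u_k^\circ)$ for $k=0,\dots,N-2$, then $u_{N-1}^\circ\leftarrow\hat K(x_{N-1}^\circ-x^r)+u^r$ and $x_N^\circ\leftarrow f(x_{N-1}^\circ,u_{N-1}^\circ)$. 2. For iterations $j=0,1,\dots$, until the change in objective is below a tolerance or a prescribed maximum number of iterations ($\ge 1$) is reached: linearize $h$ around $(\mathbf{x}^\circ,\mathbf{u}^\circ)$; compute $\{K_k\}$; solve (P) to obtain $(\mathbf{v},\boldsymbol{\mathcal{X}})$; update, for $k=0,\dots,N-1$, $u_k^\circ\leftarrow v_k+K_kx_k^\circ$, $x_{k+1}^\circ\leftarrow f(x_k^\circ,u_k^\circ)$ (with $x_0^\circ$ unchanged); record the optimal objective value $J^{j,n}$. 3. Apply $u[n]=u_0^\circ$.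
   Formalization: Stability and equilibrium need the whole initial feasible trajectory near (or at) the reference, or suitably chosen for each x[0] near x^r; for arbitrary feasible initial trajectories the state can leave x^r. Convergence and region of attraction cover all feasible initial trajectories. *)

theory Defs
  imports "HOL-Analysis.Analysis"
begin

definition pos_def :: "real^'n^'n \<Rightarrow> bool" where
  "pos_def P \<longleftrightarrow> transpose P = P \<and> (\<forall>x. x \<noteq> 0 \<longrightarrow> x \<bullet> (P *v x) > 0)"

definition wnorm :: "real^'n^'n \<Rightarrow> real^'n \<Rightarrow> real" where
  "wnorm P x = sqrt (x \<bullet> (P *v x))"

record ('n::finite, 'm::finite) mpc =
  dyn :: "(real^'n) \<times> (real^'m) \<Rightarrow> real^'n"
  X_set :: "(real^'n) set"
  U_set :: "(real^'m) set"
  x_ref :: "real^'n"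
  u_ref :: "real^'m"
  Q_wt :: "real^'n^'n"
  R_wt :: "real^'m^'m"
  Q_term :: "real^'n^'n"
  K_term :: "real^'n^'m"
  gam_term :: real
  horizon :: nat
  tol :: real
  max_iter :: nat

definition terminal_set :: "('n::finite, 'm::finite) mpc \<Rightarrow> (real^'n) set" where
  "terminal_set S = {x. (wnorm (Q_term S) (x - x_ref S))\<^sup>2 \<le> gam_term S}"

definition terminal_law :: "('n::finite, 'm::finite) mpc \<Rightarrow> real^'n \<Rightarrow> real^'m" where
  "terminal_law S x = K_term S *v (x - x_ref S) + u_ref S"

definition terminal_conditions :: "('n::finite, 'm::finite) mpc \<Rightarrow> bool" where
  "terminal_conditions S \<longleftrightarrow>
     pos_def (Q_term S) \<and> gam_term S > 0 \<and>
     terminal_set S \<subseteq> X_set S \<and>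
     (\<forall>x \<in> terminal_set S. terminal_law S x \<in> U_set S) \<and>
     (\<forall>x \<in> terminal_set S.
        (wnorm (Q_term S) (x - x_ref S))\<^sup>2 \<ge>
          (wnorm (Q_term S) (dyn S (x, terminal_law S x) - x_ref S))\<^sup>2
          + (wnorm (Q_wt S) (x - x_ref S))\<^sup>2
          + (wnorm (R_wt S) (K_term S *v (x - x_ref S)))\<^sup>2)"

text \<open>A cross section \<open>{x. \<Gamma> x \<le> q}\<close> is represented by its offset vector \<open>q\<close>, indexed by the rows of
  \<open>\<Gamma>\<close>, together with the map sending \<open>q\<close> to its list of vertices.

  For elementwise bounds the rows are indexed by \<open>'n + 'n\<close>: \<open>q $ Inl l\<close> is the upper bound
  \<open>[q\<^sub>2]\<^sub>l\<close> and \<open>q $ Inr l\<close> is \<open>-[q\<^sub>1]\<^sub>l\<close>. For simplices they are indexed by \<open>'n option\<close>: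
  \<open>q $ Some l\<close> is \<open>[\<alpha>]\<^sub>l\<close> and \<open>q $ None\<close> is \<open>\<beta>\<close>. Nonemptiness of the cross sections is not imposed
  separately; \<open>q\<^sub>1 \<le> q\<^sub>2\<close> and \<open>\<sigma> \<ge> 0\<close> follow from the constraints of the optimization problem.\<close>

definition box_Gamma :: "real^'n^('n::finite + 'n)" where
  "box_Gamma = (\<chi> i. case i of Inl l \<Rightarrow> axis l 1 | Inr l \<Rightarrow> - axis l 1)"

definition box_vertices :: "real^('n::finite + 'n) \<Rightarrow> (real^'n) set" where
  "box_vertices q = {x. \<forall>l. x $ l \<in> {- (q $ Inr l), q $ Inl l}}"

definition simplex_Gamma :: "real^'n^('n::finite option)" where
  "simplex_Gamma = (\<chi> i. case i of Some l \<Rightarrow> - axis l 1 | None \<Rightarrow> (\<chi> l. 1))"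

definition simplex_vertices :: "real^('n::finite option) \<Rightarrow> (real^'n) set" where
  "simplex_vertices q =
     (let \<alpha> = (\<chi> l. q $ Some l); \<sigma> = q $ None + (\<Sum>l\<in>UNIV. \<alpha> $ l)
      in insert (- \<alpha>) (range (\<lambda>l. - \<alpha> + \<sigma> *\<^sub>R axis l 1)))"

definition dc_form ::
  "real^'n^'r \<Rightarrow> ((real^'n) \<times> (real^'m) \<Rightarrow> real^'n) \<Rightarrow>
   ((real^'n) \<times> (real^'m) \<Rightarrow> real^'r) \<Rightarrow> ((real^'n) \<times> (real^'m) \<Rightarrow> real^'r) \<Rightarrow> bool" where
  "dc_form \<Gamma> f g h \<longleftrightarrow>
     (\<forall>z. \<Gamma> *v f z = g z - h z) \<and>
     (\<forall>i. convex_on UNIV (\<lambda>z. g z $ i)) \<and>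
     (\<forall>i. convex_on UNIV (\<lambda>z. h z $ i)) \<and>
     h differentiable_on UNIV"

definition taylor1 :: "('a::real_normed_vector \<Rightarrow> 'b::real_normed_vector) \<Rightarrow> 'a \<Rightarrow> 'a \<Rightarrow> 'b" where
  "taylor1 h z0 z = h z0 + frechet_derivative h (at z0) (z - z0)"

text \<open>A trajectory \<open>(xs, us)\<close> is a pair of sequences of which only \<open>xs 0, \<dots>, xs N\<close> and
  \<open>us 0, \<dots>, us (N - 1)\<close> are meaningful.\<close>

type_synonym ('n, 'm) traj = "(nat \<Rightarrow> real^'n) \<times> (nat \<Rightarrow> real^'m)"

definition feasible_traj :: "('n::finite, 'm::finite) mpc \<Rightarrow> ('n, 'm) traj \<Rightarrow> bool" where
  "feasible_traj S z \<longleftrightarrow>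
     (\<forall>k < horizon S. fst z (Suc k) = dyn S (fst z k, snd z k)
        \<and> fst z k \<in> X_set S \<and> snd z k \<in> U_set S) \<and>
     (wnorm (Q_term S) (fst z (horizon S) - x_ref S))\<^sup>2 \<le> gam_term S"

definition feasible_states :: "('n::finite, 'm::finite) mpc \<Rightarrow> (real^'n) set" where
  "feasible_states S = {x0. \<exists>z. feasible_traj S z \<and> fst z 0 = x0}"

primrec rollout ::
  "((real^'n) \<times> (real^'m) \<Rightarrow> real^'n) \<Rightarrow> real^'n \<Rightarrow> (nat \<Rightarrow> real^'n \<Rightarrow> real^'m) \<Rightarrow> nat \<Rightarrow> real^'n" where
  "rollout f x0 \<pi> 0 = x0"
| "rollout f x0 \<pi> (Suc k) = f (rollout f x0 \<pi> k, \<pi> k (rollout f x0 \<pi> k))"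

definition policy_traj ::
  "((real^'n) \<times> (real^'m) \<Rightarrow> real^'n) \<Rightarrow> real^'n \<Rightarrow> (nat \<Rightarrow> real^'n \<Rightarrow> real^'m) \<Rightarrow> ('n, 'm) traj" where
  "policy_traj f x0 \<pi> = (rollout f x0 \<pi>, \<lambda>k. \<pi> k (rollout f x0 \<pi> k))"

definition shift_traj ::
  "('n::finite, 'm::finite) mpc \<Rightarrow> real^'n \<Rightarrow> ('n, 'm) traj \<Rightarrow> ('n, 'm) traj" where
  "shift_traj S x0 z = policy_traj (dyn S) x0
     (\<lambda>k x. if Suc k < horizon S then snd z (Suc k) else terminal_law S x)"

definition A_mat :: "('n::finite, 'm::finite) mpc \<Rightarrow> ('n, 'm) traj \<Rightarrow> nat \<Rightarrow> real^'n^'n" where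
  "A_mat S z k = jacobian (\<lambda>x. dyn S (x, snd z k)) (at (fst z k))"

definition B_mat :: "('n::finite, 'm::finite) mpc \<Rightarrow> ('n, 'm) traj \<Rightarrow> nat \<Rightarrow> real^'m^'n" where
  "B_mat S z k = jacobian (\<lambda>u. dyn S (fst z k, u)) (at (snd z k))"

definition riccati_Delta :: "real^'m^'n \<Rightarrow> real^'m^'m \<Rightarrow> real^'n^'n \<Rightarrow> real^'m^'m" where
  "riccati_Delta B R P = transpose B ** P ** B + R"

text \<open>Backward recursion: \<open>riccati_P S z j\<close> is the matrix \<open>P\<^sub>k\<close> with \<open>k = N - j\<close>.\<close>

primrec riccati_P :: "('n::finite, 'm::finite) mpc \<Rightarrow> ('n, 'm) traj \<Rightarrow> nat \<Rightarrow> real^'n^'n" where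
  "riccati_P S z 0 = Q_term S"
| "riccati_P S z (Suc j) =
     (let A = A_mat S z (horizon S - Suc j); B = B_mat S z (horizon S - Suc j);
          P = riccati_P S z j
      in Q_wt S + transpose A ** P ** A
         - transpose A ** P ** B ** matrix_inv (riccati_Delta B (R_wt S) P)
             ** transpose B ** P ** A)"

definition gain :: "('n::finite, 'm::finite) mpc \<Rightarrow> ('n, 'm) traj \<Rightarrow> nat \<Rightarrow> real^'n^'m" where
  "gain S z k =
     (let A = A_mat S z k; B = B_mat S z k; P = riccati_P S z (horizon S - Suc k)
      in - (matrix_inv (riccati_Delta B (R_wt S) P) ** transpose B ** P ** A))"

definition tube_feasible ::
  "('n::finite, 'm::finite) mpc \<Rightarrow> (real^'r \<Rightarrow> (real^'n) set) \<Rightarrow>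
   ((real^'n) \<times> (real^'m) \<Rightarrow> real^'r) \<Rightarrow> ((real^'n) \<times> (real^'m) \<Rightarrow> real^'r) \<Rightarrow> ('n, 'm) traj \<Rightarrow>
   (nat \<Rightarrow> real^'m) \<Rightarrow> (nat \<Rightarrow> real^'r) \<Rightarrow> (nat \<Rightarrow> real) \<Rightarrow> (nat \<Rightarrow> real) \<Rightarrow> bool" where
  "tube_feasible S V g h z v q \<theta> \<eta> \<longleftrightarrow>
     (\<forall>k < horizon S. \<forall>x \<in> V (q k).
        let u = v k + gain S z k *v x in
          wnorm (Q_wt S) (x - x_ref S) \<le> \<theta> k \<and>
          wnorm (R_wt S) (u - u_ref S) \<le> \<eta> k \<and>
          (\<forall>i. (g (x, u) - taylor1 h (fst z k, snd z k) (x, u)) $ i \<le> q (Suc k) $ i) \<and>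
          x \<in> X_set S \<and> u \<in> U_set S) \<and>
     (\<forall>x \<in> V (q (horizon S)). wnorm (Q_term S) (x - x_ref S) \<le> \<theta> (horizon S)) \<and>
     \<theta> (horizon S) \<le> sqrt (gam_term S) \<and>
     (\<forall>x \<in> V (q 0). x = fst z 0)"

definition tube_objective ::
  "('n::finite, 'm::finite) mpc \<Rightarrow> (nat \<Rightarrow> real) \<Rightarrow> (nat \<Rightarrow> real) \<Rightarrow> real" where
  "tube_objective S \<theta> \<eta> =
     (\<theta> (horizon S))\<^sup>2 + (\<Sum>k<horizon S. (\<theta> k)\<^sup>2 + (\<eta> k)\<^sup>2)"

definition tube_optimal ::
  "('n::finite, 'm::finite) mpc \<Rightarrow> (real^'r \<Rightarrow> (real^'n) set) \<Rightarrow>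
   ((real^'n) \<times> (real^'m) \<Rightarrow> real^'r) \<Rightarrow> ((real^'n) \<times> (real^'m) \<Rightarrow> real^'r) \<Rightarrow> ('n, 'm) traj \<Rightarrow>
   (nat \<Rightarrow> real^'m) \<Rightarrow> (nat \<Rightarrow> real^'r) \<Rightarrow> (nat \<Rightarrow> real) \<Rightarrow> (nat \<Rightarrow> real) \<Rightarrow> bool" where
  "tube_optimal S V g h z v q \<theta> \<eta> \<longleftrightarrow>
     tube_feasible S V g h z v q \<theta> \<eta> \<and>
     (\<forall>v' q' \<theta>' \<eta>'. tube_feasible S V g h z v' q' \<theta>' \<eta>' \<longrightarrow>
        tube_objective S \<theta> \<eta> \<le> tube_objective S \<theta>' \<eta>')"

text \<open>Any minimizer may be returned by the solver; \<open>J\<close> is the optimal value.\<close>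

definition sl_iteration ::
  "('n::finite, 'm::finite) mpc \<Rightarrow> (real^'r \<Rightarrow> (real^'n) set) \<Rightarrow>
   ((real^'n) \<times> (real^'m) \<Rightarrow> real^'r) \<Rightarrow> ((real^'n) \<times> (real^'m) \<Rightarrow> real^'r) \<Rightarrow>
   ('n, 'm) traj \<Rightarrow> real \<Rightarrow> ('n, 'm) traj \<Rightarrow> bool" where
  "sl_iteration S V g h z J z' \<longleftrightarrow>
     (\<exists>v q \<theta> \<eta>. tube_optimal S V g h z v q \<theta> \<eta> \<and> J = tube_objective S \<theta> \<eta> \<and>
        z' = policy_traj (dyn S) (fst z 0) (\<lambda>k x. v k + gain S z k *v x))"

text \<open>Stopping test evaluated after iteration \<open>j\<close> (numbered from 0). The change in objective is
  only available from the second iteration on.\<close>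

definition stops :: "('n::finite, 'm::finite) mpc \<Rightarrow> (nat \<Rightarrow> real) \<Rightarrow> nat \<Rightarrow> bool" where
  "stops S J j \<longleftrightarrow> Suc j = max_iter S \<or> (0 < j \<and> \<bar>J j - J (j - 1)\<bar> < tol S)"

definition step2 ::
  "('n::finite, 'm::finite) mpc \<Rightarrow> (real^'r \<Rightarrow> (real^'n) set) \<Rightarrow>
   ((real^'n) \<times> (real^'m) \<Rightarrow> real^'r) \<Rightarrow> ((real^'n) \<times> (real^'m) \<Rightarrow> real^'r) \<Rightarrow>
   ('n, 'm) traj \<Rightarrow> ('n, 'm) traj \<Rightarrow> bool" where
  "step2 S V g h z z' \<longleftrightarrow>
     (\<exists>T J l. T 0 = z \<and> T (Suc l) = z' \<and>
        (\<forall>j \<le> l. sl_iteration S V g h (T j) (J j) (T (Suc j))) \<and>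
        stops S J l \<and> (\<forall>j < l. \<not> stops S J j))"

text \<open>A closed-loop run with plant states \<open>x\<close>, applied inputs \<open>u\<close>, and initial feasible trajectory
  \<open>z0\<close> found at time 0. At time \<open>n\<close>, \<open>z n\<close> is the trajectory before the
  successive linearization iterations and \<open>w n\<close> the one after them.\<close>

definition closed_loop_run ::
  "('n::finite, 'm::finite) mpc \<Rightarrow> (real^'r \<Rightarrow> (real^'n) set) \<Rightarrow>
   ((real^'n) \<times> (real^'m) \<Rightarrow> real^'r) \<Rightarrow> ((real^'n) \<times> (real^'m) \<Rightarrow> real^'r) \<Rightarrow>
   ('n, 'm) traj \<Rightarrow> (nat \<Rightarrow> real^'n) \<Rightarrow> (nat \<Rightarrow> real^'m) \<Rightarrow> bool" where
  "closed_loop_run S V g h z0 x u \<longleftrightarrow>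
     feasible_traj S z0 \<and> fst z0 0 = x 0 \<and>
     (\<exists>z w. z 0 = z0 \<and>
        (\<forall>n. step2 S V g h (z n) (w n) \<and>
             u n = snd (w n) 0 \<and>
             x (Suc n) = dyn S (x n, u n) \<and>
             z (Suc n) = shift_traj S (x (Suc n)) (w n)))"

text \<open>The trajectories about which the problem may have to be solved when the algorithm is started
  from \<open>z0\<close> (over all choices of minimizers and over all numbers of iterations per time step).\<close>

inductive visited ::
  "('n::finite, 'm::finite) mpc \<Rightarrow> (real^'r \<Rightarrow> (real^'n) set) \<Rightarrow>
   ((real^'n) \<times> (real^'m) \<Rightarrow> real^'r) \<Rightarrow> ((real^'n) \<times> (real^'m) \<Rightarrow> real^'r) \<Rightarrow>
   ('n, 'm) traj \<Rightarrow> ('n, 'm) traj \<Rightarrow> bool"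
  for S V g h z0 where
  visited_start: "visited S V g h z0 z0"
| visited_iterate: "visited S V g h z0 z \<Longrightarrow> sl_iteration S V g h z J z' \<Longrightarrow> visited S V g h z0 z'"
| visited_shift: "visited S V g h z0 z \<Longrightarrow> sl_iteration S V g h z J z' \<Longrightarrow>
    visited S V g h z0 (shift_traj S (dyn S (fst z' 0, snd z' 0)) z')"

text \<open>The algorithm never gets stuck: from every feasible initial trajectory, every problem
  encountered has a minimizer.\<close>

definition closed_loop_well_defined ::
  "('n::finite, 'm::finite) mpc \<Rightarrow> (real^'r \<Rightarrow> (real^'n) set) \<Rightarrow>
   ((real^'n) \<times> (real^'m) \<Rightarrow> real^'r) \<Rightarrow> ((real^'n) \<times> (real^'m) \<Rightarrow> real^'r) \<Rightarrow> bool" where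
  "closed_loop_well_defined S V g h \<longleftrightarrow>
     (\<forall>z0 z. feasible_traj S z0 \<and> visited S V g h z0 z \<longrightarrow>
        (\<exists>v q \<theta> \<eta>. tube_optimal S V g h z v q \<theta> \<eta>))"

text \<open>The controller is dynamic: its state is the stored trajectory, whose initial value is chosen at
  time 0. The equilibrium is the constant trajectory at the reference, and Lyapunov stability is
  understood for perturbations of this closed-loop state. Proximity of \<open>x 0\<close> alone to the reference
  does not suffice when the initial trajectory is an arbitrary feasible one. For example, take
  \<open>f (x, u) = u\<close>, zero reference, horizon 1, \<open>X = U = [-1, 1]\<close>, unit weights, \<open>K_term = 0\<close>,
  \<open>gam_term = 1\<close>, \<open>max_iter = 1\<close>, elementwise bounds, \<open>g = (u + u^2, -u + u^2)\<close> and
  \<open>h = (u^2, u^2)\<close>. The initial trajectory \<open>x\<^sub>0 = 0, u\<^sub>0 = 1, x\<^sub>1 = 1\<close> is feasible, and the problem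
  amounts to minimizing \<open>v^2 + (\<bar>v\<bar> + (v - 1)^2)^2\<close> subject to \<open>\<bar>v\<bar> + (v - 1)^2 \<le> 1\<close>. Its minimizer
  is positive, so the applied input moves the state off the equilibrium.

  The second conjunct of \<open>lyapunov_stable\<close> removes the initial trajectory from the hypotheses:
  every initial state near the reference has a feasible initial trajectory from which all runs stay
  near the reference.\<close>

definition near_reference ::
  "('n::finite, 'm::finite) mpc \<Rightarrow> real \<Rightarrow> ('n, 'm) traj \<Rightarrow> bool" where
  "near_reference S d z \<longleftrightarrow>
     (\<forall>k \<le> horizon S. norm (fst z k - x_ref S) < d) \<and>
     (\<forall>k < horizon S. norm (snd z k - u_ref S) < d)"

definition closed_loop_equilibrium ::
  "('n::finite, 'm::finite) mpc \<Rightarrow> (real^'r \<Rightarrow> (real^'n) set) \<Rightarrow>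
   ((real^'n) \<times> (real^'m) \<Rightarrow> real^'r) \<Rightarrow> ((real^'n) \<times> (real^'m) \<Rightarrow> real^'r) \<Rightarrow> bool" where
  "closed_loop_equilibrium S V g h \<longleftrightarrow>
     dyn S (x_ref S, u_ref S) = x_ref S \<and>
     feasible_traj S (\<lambda>_. x_ref S, \<lambda>_. u_ref S) \<and>
     (\<forall>x u. closed_loop_run S V g h (\<lambda>_. x_ref S, \<lambda>_. u_ref S) x u \<longrightarrow>
        (\<forall>n. x n = x_ref S \<and> u n = u_ref S))"

definition lyapunov_stable ::
  "('n::finite, 'm::finite) mpc \<Rightarrow> (real^'r \<Rightarrow> (real^'n) set) \<Rightarrow>
   ((real^'n) \<times> (real^'m) \<Rightarrow> real^'r) \<Rightarrow> ((real^'n) \<times> (real^'m) \<Rightarrow> real^'r) \<Rightarrow> bool" where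
  "lyapunov_stable S V g h \<longleftrightarrow>
     (\<forall>\<epsilon>>0. \<exists>\<delta>>0. \<forall>z0 x u.
        near_reference S \<delta> z0 \<and> closed_loop_run S V g h z0 x u \<longrightarrow>
        (\<forall>n. norm (x n - x_ref S) < \<epsilon>)) \<and>
     (\<forall>\<epsilon>>0. \<exists>\<delta>>0. \<forall>x0. norm (x0 - x_ref S) < \<delta> \<longrightarrow>
        (\<exists>z0. feasible_traj S z0 \<and> fst z0 0 = x0 \<and>
           (\<forall>x u. closed_loop_run S V g h z0 x u \<longrightarrow> (\<forall>n. norm (x n - x_ref S) < \<epsilon>))))"

definition locally_attractive ::
  "('n::finite, 'm::finite) mpc \<Rightarrow> (real^'r \<Rightarrow> (real^'n) set) \<Rightarrow>
   ((real^'n) \<times> (real^'m) \<Rightarrow> real^'r) \<Rightarrow> ((real^'n) \<times> (real^'m) \<Rightarrow> real^'r) \<Rightarrow> bool" where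
  "locally_attractive S V g h \<longleftrightarrow>
     (\<exists>\<delta>>0. \<forall>z0 x u.
        norm (x 0 - x_ref S) < \<delta> \<and> closed_loop_run S V g h z0 x u \<longrightarrow> x \<longlonglongrightarrow> x_ref S)"

definition asymptotically_stable ::
  "('n::finite, 'm::finite) mpc \<Rightarrow> (real^'r \<Rightarrow> (real^'n) set) \<Rightarrow>
   ((real^'n) \<times> (real^'m) \<Rightarrow> real^'r) \<Rightarrow> ((real^'n) \<times> (real^'m) \<Rightarrow> real^'r) \<Rightarrow> bool" where
  "asymptotically_stable S V g h \<longleftrightarrow>
     closed_loop_equilibrium S V g h \<and> lyapunov_stable S V g h \<and> locally_attractive S V g h"

text \<open>Initial states from which the closed loop can be run and from which every run, whatever the
  initial feasible trajectory and the minimizers returned, converges to the reference.\<close>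

definition region_of_attraction ::
  "('n::finite, 'm::finite) mpc \<Rightarrow> (real^'r \<Rightarrow> (real^'n) set) \<Rightarrow>
   ((real^'n) \<times> (real^'m) \<Rightarrow> real^'r) \<Rightarrow> ((real^'n) \<times> (real^'m) \<Rightarrow> real^'r) \<Rightarrow> (real^'n) set" where
  "region_of_attraction S V g h =
     {x0. (\<exists>z0 x u. closed_loop_run S V g h z0 x u \<and> x 0 = x0) \<and>
          (\<forall>z0 x u. closed_loop_run S V g h z0 x u \<and> x 0 = x0 \<longrightarrow> x \<longlonglongrightarrow> x_ref S)}"

end

theory Submission
  imports Defs
begin

text \<open>The cost of the stored feasible trajectory \<open>z\<close>, that is the sum of its squared stage and
  terminal norms, serves as a Lyapunov function of the closed loop.

  A linearization step around \<open>z\<close> does not increase the cost. On the one hand, the tube whose cross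
  sections are the single points of \<open>z\<close> is admissible and its objective is the cost of \<open>z\<close>
  (\<open>nominal_tube\<close>), so the optimal value is at most this cost. On the other hand, the trajectory
  produced from any admissible tube stays inside the tube and costs at most the objective
  (\<open>tube_feasible_rollout\<close>). Convexity gives the second fact: \<open>\<Gamma> f = g - h\<close> is bounded above by \<open>g\<close>
  minus the linearization of \<open>h\<close>, since a convex function lies above its tangents; this bound is
  convex in the state under an affine feedback, so the inequalities imposed at the vertices hold on
  the whole cross section and confine the successor state to the next one.

  By the terminal inequality, shifting the trajectory lowers the cost by at least the stage cost
  of the applied pair (\<open>feasible_shift_traj\<close>). Hence the stage costs along a run add up to at most
  the cost of the initial trajectory (\<open>run_cost_sum\<close>), which forces convergence to the reference
  from every feasible start. It also bounds every single stage cost, which gives stability: the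
  cost is small for trajectories close to the reference, and for an initial state close to the
  reference the terminal law generates a feasible trajectory of small cost (\<open>terminal_law_traj\<close>).

  Since feasibility persists in each step, it remains to see that the problem around a feasible
  trajectory has a minimizer (\<open>tube_optimal_exists\<close>): the constraints are closed, and the admissible
  tubes with objective at most the nominal cost are bounded, because \<open>X\<close>, \<open>U\<close> and the terminal set
  are bounded and the vertices of a cross section bound its offsets.\<close>

section \<open>Weighted norms\<close>

lemma pos_def_quadratic_nonneg:
  assumes "pos_def P" shows "0 \<le> x \<bullet> (P *v x)"
  using assms unfolding pos_def_def by (cases "x = 0") (auto intro: less_imp_le)

lemma wnorm_nonneg:
  assumes "pos_def P" shows "0 \<le> wnorm P x"
  unfolding wnorm_def using pos_def_quadratic_nonneg[OF assms] by simp

lemma wnorm_zero [simp]: "wnorm P 0 = 0"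
  unfolding wnorm_def by simp

lemma continuous_on_wnorm [continuous_intros]:
  assumes "continuous_on A f" shows "continuous_on A (\<lambda>x. wnorm P (f x))"
  unfolding wnorm_def
  by (intro continuous_intros assms bounded_linear.continuous_on[OF matrix_vector_mul_bounded_linear])

lemma wnorm_scaleR: "wnorm P (c *\<^sub>R x) = \<bar>c\<bar> * wnorm P x"
proof -
  have "(c *\<^sub>R x) \<bullet> (P *v (c *\<^sub>R x)) = c\<^sup>2 * (x \<bullet> (P *v x))"
    by (simp add: matrix_vector_mult_scaleR power2_eq_square)
  then show ?thesis
    unfolding wnorm_def by (simp add: real_sqrt_mult)
qed

text \<open>The constant is the minimum of the weighted norm on the unit sphere.\<close>

lemma wnorm_ge_norm:
  fixes P :: "real^'n^'n"
  assumes "pos_def P"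
  obtains a where "a > 0" "\<And>x. a * norm x \<le> wnorm P x"
proof -
  have "compact (sphere (0::real^'n) 1)" "sphere (0::real^'n) 1 \<noteq> {}"
    by auto
  then obtain y where y: "norm y = 1" "\<And>x. norm x = 1 \<Longrightarrow> wnorm P y \<le> wnorm P x"
    using continuous_attains_inf[of "sphere 0 1" "wnorm P"]
      continuous_on_wnorm[OF continuous_on_id, of _ P] by auto
  have "y \<bullet> (P *v y) > 0"
    using assms y(1) unfolding pos_def_def by (metis norm_zero zero_neq_one)
  then have "wnorm P y > 0"
    unfolding wnorm_def by simp
  moreover have "wnorm P y * norm x \<le> wnorm P x" for x
  proof (cases "x = 0")
    case False
    have "wnorm P x = norm x * wnorm P ((1 / norm x) *\<^sub>R x)"
      using False by (simp add: wnorm_scaleR)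
    moreover have "wnorm P y \<le> wnorm P ((1 / norm x) *\<^sub>R x)"
      using False by (intro y(2)) simp
    ultimately show ?thesis
      by (metis mult.commute mult_left_mono norm_ge_zero)
  qed simp
  ultimately show thesis
    using that by blast
qed

lemma wnorm_le_norm:
  fixes P :: "real^'n^'n"
  obtains b where "b \<ge> 0" "\<And>x. wnorm P x \<le> b * norm x"
proof -
  obtain K where K: "K \<ge> 0" "\<And>x. norm (P *v x) \<le> norm x * K"
    using bounded_linear.nonneg_bounded[OF matrix_vector_mul_bounded_linear[of P]] by auto
  have "wnorm P x \<le> sqrt K * norm x" for x
  proof -
    have "x \<bullet> (P *v x) \<le> norm x * norm (P *v x)"
      by (rule norm_cauchy_schwarz)
    also have "\<dots> \<le> norm x * (norm x * K)"
      by (intro mult_left_mono K) auto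
    also have "\<dots> = K * (norm x)\<^sup>2"
      by (simp add: power2_eq_square)
    finally have "sqrt (x \<bullet> (P *v x)) \<le> sqrt (K * (norm x)\<^sup>2)"
      by simp
    then show ?thesis
      unfolding wnorm_def by (simp add: real_sqrt_mult)
  qed
  then show thesis
    using that[of "sqrt K"] K(1) by simp
qed

text \<open>For weights \<open>s + t = 1\<close> the gap in Jensen's inequality for \<open>x \<mapsto> x \<bullet> P x\<close> is
  \<open>s t (x - y) \<bullet> P (x - y)\<close>.\<close>

lemma convex_wnorm_sublevel:
  fixes P :: "real^'n^'n"
  assumes "pos_def P"
  shows "convex {x. wnorm P (x - c) \<le> r}"
proof (cases "r \<ge> 0")
  case False
  then have "{x. wnorm P (x - c) \<le> r} = {}"
    using wnorm_nonneg[OF assms] by (auto simp: not_le) (meson less_le_not_le order_trans)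
  then show ?thesis by simp
next
  case True
  let ?q = "\<lambda>x. x \<bullet> (P *v x)"
  have level: "wnorm P x \<le> r \<longleftrightarrow> ?q x \<le> r\<^sup>2" for x
    unfolding wnorm_def using True pos_def_quadratic_nonneg[OF assms]
    by (metis real_sqrt_le_iff real_sqrt_unique)
  show ?thesis
  proof (rule convexI, unfold mem_Collect_eq level)
    fix x y and s t :: real
    assume x: "?q (x - c) \<le> r\<^sup>2" and y: "?q (y - c) \<le> r\<^sup>2"
      and st: "0 \<le> s" "0 \<le> t" "s + t = 1"
    define x' y' where "x' = x - c" and "y' = y - c"
    have c: "s *\<^sub>R x + t *\<^sub>R y - c = s *\<^sub>R x' + t *\<^sub>R y'"
      unfolding x'_def y'_def using st(3)
      by (simp add: algebra_simps flip: scaleR_add_left)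
    have t: "t = 1 - s" using st by simp
    have "?q (s *\<^sub>R x' + t *\<^sub>R y') = s * ?q x' + t * ?q y' - s * t * ?q (x' - y')"
      unfolding t
      by (simp add: matrix_vector_mult_scaleR matrix_vector_right_distrib
          matrix_vector_mult_diff_distrib inner_add_left inner_add_right inner_diff_left
          inner_diff_right algebra_simps)
    also have "\<dots> \<le> s * r\<^sup>2 + t * r\<^sup>2"
      using mult_left_mono[OF x st(1)] mult_left_mono[OF y st(2)]
        mult_nonneg_nonneg[OF mult_nonneg_nonneg[OF st(1,2)] pos_def_quadratic_nonneg[OF assms, of "x' - y'"]]
      unfolding x'_def y'_def by linarith
    also have "\<dots> = r\<^sup>2"
      using st(3) by (simp flip: distrib_right)
    finally show "?q (s *\<^sub>R x + t *\<^sub>R y - c) \<le> r\<^sup>2"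
      unfolding c .
  qed
qed

lemma bounded_wnorm_sublevel:
  fixes P :: "real^'n^'n"
  assumes "pos_def P"
  shows "bounded {x. wnorm P (x - c) \<le> r}"
proof -
  obtain a where a: "a > 0" "\<And>x. a * norm x \<le> wnorm P x"
    using wnorm_ge_norm[OF assms] by blast
  have "norm (x - c) \<le> r / a" if "wnorm P (x - c) \<le> r" for x
    using order_trans[OF a(2) that] a(1) by (simp add: pos_le_divide_eq mult.commute)
  then show ?thesis
    by (intro boundedI[of _ "r / a + norm c"]) (smt (verit) mem_Collect_eq norm_triangle_sub)
qed

section \<open>Convex functions and convex hulls\<close>

text \<open>Restriction to the line through \<open>x\<close> and \<open>y\<close> reduces this to functions of one real variable.\<close>

lemma convex_on_ge_tangent:
  fixes \<phi> :: "'a::real_normed_vector \<Rightarrow> real"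
  assumes "convex_on UNIV \<phi>" and "(\<phi> has_derivative D) (at x)"
  shows "\<phi> x + D (y - x) \<le> \<phi> y"
proof -
  define \<psi> where "\<psi> = (\<lambda>t::real. \<phi> (x + t *\<^sub>R (y - x)))"
  have "convex_on UNIV \<psi>"
  proof (rule convex_onI)
    fix s a b :: real assume s: "0 < s" "s < 1"
    have "x + ((1 - s) *\<^sub>R a + s *\<^sub>R b) *\<^sub>R (y - x)
        = (1 - s) *\<^sub>R (x + a *\<^sub>R (y - x)) + s *\<^sub>R (x + b *\<^sub>R (y - x))"
      by (simp add: algebra_simps)
    then show "\<psi> ((1 - s) *\<^sub>R a + s *\<^sub>R b) \<le> (1 - s) * \<psi> a + s * \<psi> b"
      unfolding \<psi>_def using convex_onD[OF assms(1), of s "x + a *\<^sub>R (y - x)" "x + b *\<^sub>R (y - x)"] s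
      by simp
  qed simp
  moreover have "(\<psi> has_field_derivative D (y - x)) (at 0 within UNIV)"
  proof -
    have "((\<lambda>t. x + t *\<^sub>R (y - x)) has_derivative (\<lambda>t. t *\<^sub>R (y - x))) (at 0)"
      by (auto intro!: derivative_eq_intros)
    from has_derivative_compose[OF this, of \<phi> D]
    have "(\<psi> has_derivative (\<lambda>t. D (t *\<^sub>R (y - x)))) (at 0)"
      using assms(2) unfolding \<psi>_def by simp
    moreover have "(\<lambda>t. D (t *\<^sub>R (y - x))) = (\<lambda>t. D (y - x) * t)"
      using linear_scale[OF has_derivative_linear[OF assms(2)]] by (auto simp: fun_eq_iff)
    ultimately show ?thesis
      by (simp add: has_field_derivative_def mult_commute_abs)
  qed
  ultimately have "\<psi> 1 - \<psi> 0 \<ge> D (y - x) * (1 - 0)"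
    by (intro convex_on_imp_above_tangent[of UNIV]) auto
  then show ?thesis
    unfolding \<psi>_def by simp
qed

text \<open>A linear functional separating \<open>x\<close> from the finitely generated (hence closed) hull would
  exceed its values on all generators.\<close>

lemma in_convex_hull_if_support:
  fixes x :: "'a::euclidean_space"
  assumes "finite F" and "\<And>a. \<exists>v\<in>F. a \<bullet> x \<le> a \<bullet> v"
  shows "x \<in> convex hull F"
proof (rule ccontr)
  assume "x \<notin> convex hull F"
  then obtain a b where ab: "a \<bullet> x < b" "\<And>y. y \<in> convex hull F \<Longrightarrow> a \<bullet> y > b"
    using separating_hyperplane_closed_point[of "convex hull F" x] assms(1)
    by (auto simp: compact_imp_closed finite_imp_compact_convex_hull)
  obtain v where "v \<in> F" "(- a) \<bullet> x \<le> (- a) \<bullet> v"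
    using assms(2) by blast
  with ab(1) ab(2)[of v] show False
    by (auto simp: hull_inc)
qed

text \<open>Tychonoff's theorem, for the sequences over which the optimization problem ranges.\<close>

lemma compact_Pi_UNIV:
  fixes C :: "'i \<Rightarrow> 'b::topological_space set"
  assumes "\<And>i. compact (C i)"
  shows "compact {f. \<forall>i. f i \<in> C i}"
proof -
  have "compactin (product_topology (\<lambda>i. euclidean) UNIV) (PiE UNIV C)"
    using assms by (simp add: compactin_PiE)
  then have "compact (PiE UNIV C)"
    by (simp add: euclidean_product_topology)
  moreover have "PiE UNIV C = {f. \<forall>i. f i \<in> C i}"
    by (auto simp: PiE_def)
  ultimately show ?thesis by simp
qed

section \<open>Tube parameterizations\<close>

text \<open>These properties are all that the closed-loop analysis needs to know about cross sections.
  Continuous vertex functions make the constraints at the vertices closed conditions on the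
  offsets, and coercivity bounds the offsets of admissible tubes. Single points as cross sections
  make a feasible trajectory an admissible tube. The inclusion of the polytope in the hull of
  \<open>V q\<close> can be asked of all offsets because the polytope is empty whenever the points of \<open>V q\<close> are
  not its vertices, as for crossed elementwise bounds.\<close>

locale tube_parameterization =
  fixes \<Gamma> :: "real^'n^'r" and V :: "real^'r \<Rightarrow> (real^'n) set"
  assumes vertex_functions:
      "\<exists>F. (\<forall>\<phi>\<in>F. continuous_on UNIV \<phi>) \<and> (\<forall>q. V q = (\<lambda>\<phi>. \<phi> q) ` F)"
    and vertices_singleton: "V (\<Gamma> *v x) = {x}"
    and polytope_subset_hull: "(\<And>i. (\<Gamma> *v x) $ i \<le> q $ i) \<Longrightarrow> x \<in> convex hull V q"
    and vertices_coercive: "bounded B \<Longrightarrow> bounded {q. V q \<subseteq> B}"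
begin

lemma vertices_nonempty: "V q \<noteq> {}"
  using vertex_functions vertices_singleton by (metis image_is_empty insert_not_empty)

end

lemma box_Gamma_mult [simp]:
  "(box_Gamma *v x) $ Inl l = x $ l" "(box_Gamma *v x) $ Inr l = - x $ l"
  by (simp_all add: box_Gamma_def matrix_vector_mul_component inner_axis' row_def)

lemma box_vertices_eq:
  "box_vertices q = (\<lambda>\<phi>. \<phi> q) ` range (\<lambda>b q. \<chi> l. if b l then q $ Inl l else - (q $ Inr l))"
proof (intro equalityI subsetI)
  fix x assume "x \<in> box_vertices q"
  then have "x = (\<chi> l. if x $ l = q $ Inl l then q $ Inl l else - (q $ Inr l))"
    by (auto simp: box_vertices_def vec_eq_iff)
  then show "x \<in> (\<lambda>\<phi>. \<phi> q) ` range (\<lambda>b q. \<chi> l. if b l then q $ Inl l else - (q $ Inr l))"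
    unfolding image_image by (rule range_eqI[where x = "\<lambda>l. x $ l = q $ Inl l"])
qed (auto simp: box_vertices_def)

text \<open>A linear functional is maximized over the box coordinatewise, at the vertex chosen by the signs
  of its coefficients. Up to sign, every offset is a coordinate of the corner with all upper bounds or
  of the one with all lower bounds, so a bound on the vertices bounds the offsets.\<close>

lemma box_parameterization: "tube_parameterization box_Gamma box_vertices"
proof
  show "\<exists>F. (\<forall>\<phi>\<in>F. continuous_on UNIV \<phi>) \<and> (\<forall>q. box_vertices q = (\<lambda>\<phi>. \<phi> q) ` F)"
  proof (intro exI conjI allI ballI)
    fix \<phi> :: "real^('n + 'n) \<Rightarrow> real^'n"
    assume "\<phi> \<in> range (\<lambda>b q. \<chi> l. if b l then q $ Inl l else - (q $ Inr l))"
    then obtain b where \<phi>: "\<phi> = (\<lambda>q. \<chi> l. if b l then q $ Inl l else - (q $ Inr l))"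
      by blast
    have "continuous_on UNIV (\<lambda>q::real^('n + 'n). if b l then q $ Inl l else - (q $ Inr l))" for l
      by (cases "b l") (simp_all add: continuous_on_minus continuous_on_component)
    then show "continuous_on UNIV \<phi>"
      unfolding \<phi> by (rule continuous_on_vec_lambda)
  qed (rule box_vertices_eq)
next
  fix x :: "real^'n"
  show "box_vertices (box_Gamma *v x) = {x}"
    by (auto simp: box_vertices_def vec_eq_iff)
next
  fix x :: "real^'n" and q
  assume x: "\<And>i. (box_Gamma *v x) $ i \<le> q $ i"
  have fin: "finite (box_vertices q)"
    unfolding box_vertices_eq by simp
  show "x \<in> convex hull box_vertices q"
  proof (rule in_convex_hull_if_support[OF fin])
    fix a :: "real^'n"
    define v :: "real^'n" where "v = (\<chi> l. if a $ l \<ge> 0 then q $ Inl l else - (q $ Inr l))"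
    have "a $ l * x $ l \<le> a $ l * v $ l" for l
    proof (cases "a $ l \<ge> 0")
      case True
      then show ?thesis
        using x[of "Inl l"] by (simp add: v_def mult_left_mono)
    next
      case False
      then show ?thesis
        using mult_left_mono_neg[of "- (q $ Inr l)" "x $ l" "a $ l"] x[of "Inr l"]
        by (simp add: v_def)
    qed
    then have "a \<bullet> x \<le> a \<bullet> v"
      by (simp add: inner_vec_def sum_mono)
    moreover have "v \<in> box_vertices q"
      by (simp add: box_vertices_def v_def)
    ultimately show "\<exists>v\<in>box_vertices q. a \<bullet> x \<le> a \<bullet> v" by blast
  qed
next
  fix B :: "(real^'n) set"
  assume "bounded B"
  then obtain M where M: "\<And>x. x \<in> B \<Longrightarrow> norm x \<le> M"
    unfolding bounded_iff by blast
  have bound: "\<bar>q $ i\<bar> \<le> M" if "box_vertices q \<subseteq> B" for q i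
  proof -
    have in_B: "(\<chi> l. q $ Inl l) \<in> B" "(\<chi> l. - (q $ Inr l)) \<in> B"
      using that by (auto simp: box_vertices_def)
    show ?thesis
    proof (cases i)
      case (Inl l)
      then show ?thesis
        using component_le_norm_cart[of "\<chi> l. q $ Inl l" l] M[OF in_B(1)] by simp
    next
      case (Inr l)
      then show ?thesis
        using component_le_norm_cart[of "\<chi> l. - (q $ Inr l)" l] M[OF in_B(2)] by simp
    qed
  qed
  have "norm q \<le> (\<Sum>i\<in>(UNIV::('n + 'n) set). M)" if "box_vertices q \<subseteq> B" for q
    by (intro order_trans[OF norm_le_l1_cart] sum_mono bound that)
  then show "bounded {q. box_vertices q \<subseteq> B}"
    by (auto intro!: boundedI)
qed

lemma simplex_Gamma_mult [simp]:
  "(simplex_Gamma *v x) $ Some l = - x $ l" "(simplex_Gamma *v x) $ None = (\<Sum>l\<in>UNIV. x $ l)"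
  by (simp_all add: simplex_Gamma_def matrix_vector_mul_component inner_axis')
    (simp add: inner_vec_def)

definition simplex_size :: "real^('n::finite option) \<Rightarrow> real" where
  "simplex_size q = q $ None + (\<Sum>l\<in>UNIV. q $ Some l)"

lemma simplex_vertices_eq:
  "simplex_vertices q = (\<lambda>\<phi>. \<phi> q) `
     range (\<lambda>i q. - (\<chi> l. q $ Some l) + (case i of None \<Rightarrow> 0 | Some l \<Rightarrow> simplex_size q *\<^sub>R axis l 1))"
  by (auto simp: simplex_vertices_def simplex_size_def Let_def UNIV_option_conv image_image)

text \<open>Coordinates relative to the apex \<open>-\<alpha>\<close> are nonnegative with sum at most \<open>\<sigma>\<close>, so a functional is
  at most \<open>\<sigma>\<close> times its largest coefficient, or at most 0, relative to its value at the apex. The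
  apex bounds \<open>\<alpha>\<close>, any other vertex then bounds \<open>\<sigma>\<close>, and both together bound \<open>\<beta>\<close>.\<close>

lemma simplex_parameterization: "tube_parameterization simplex_Gamma simplex_vertices"
proof
  show "\<exists>F. (\<forall>\<phi>\<in>F. continuous_on UNIV \<phi>) \<and> (\<forall>q. simplex_vertices q = (\<lambda>\<phi>. \<phi> q) ` F)"
  proof (intro exI conjI allI ballI)
    fix \<phi> :: "real^('n option) \<Rightarrow> real^'n"
    assume "\<phi> \<in> range (\<lambda>i q. - (\<chi> l. q $ Some l) + (case i of None \<Rightarrow> 0 | Some l \<Rightarrow> simplex_size q *\<^sub>R axis l 1))"
    then obtain i where "\<phi> = (\<lambda>q. - (\<chi> l. q $ Some l) + (case i of None \<Rightarrow> 0 | Some l \<Rightarrow> simplex_size q *\<^sub>R axis l 1))"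
      by blast
    then show "continuous_on UNIV \<phi>"
      by (cases i) (auto simp: simplex_size_def intro!: continuous_intros)
  qed (rule simplex_vertices_eq)
next
  fix x :: "real^'n"
  have "simplex_size (simplex_Gamma *v x) = 0"
    by (simp add: simplex_size_def sum_negf)
  then show "simplex_vertices (simplex_Gamma *v x) = {x}"
    by (auto simp: simplex_vertices_eq image_image vec_eq_iff split: option.splits)
next
  fix x :: "real^'n" and q
  assume x: "\<And>i. (simplex_Gamma *v x) $ i \<le> q $ i"
  have fin: "finite (simplex_vertices q)"
    unfolding simplex_vertices_eq by simp
  show "x \<in> convex hull simplex_vertices q"
  proof (rule in_convex_hull_if_support[OF fin])
    fix a :: "real^'n"
    define p where "p = - (\<chi> l. q $ Some l)"
    define y where "y = x - p"
    have y: "y $ l \<ge> 0" for l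
      using x[of "Some l"] by (simp add: y_def p_def)
    have ysum: "(\<Sum>l\<in>UNIV. y $ l) \<le> simplex_size q"
      using x[of None] by (simp add: y_def p_def simplex_size_def sum.distrib)
    obtain m where m: "\<And>l. a $ l \<le> a $ m"
      using Max_in[of "range (($) a)"] Max_ge[of "range (($) a)"] by fastforce
    have le: "a \<bullet> y \<le> a $ m * (\<Sum>l\<in>UNIV. y $ l)"
      unfolding inner_vec_def sum_distrib_left by (auto intro!: sum_mono mult_right_mono m y)
    have p: "p \<in> simplex_vertices q" "p + simplex_size q *\<^sub>R axis m 1 \<in> simplex_vertices q"
      by (auto simp: simplex_vertices_def p_def simplex_size_def Let_def)
    have x_eq: "a \<bullet> x = a \<bullet> p + a \<bullet> y"
      by (simp add: y_def inner_diff_right)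
    show "\<exists>v\<in>simplex_vertices q. a \<bullet> x \<le> a \<bullet> v"
    proof (cases "a $ m \<ge> 0")
      case True
      then have "a \<bullet> y \<le> a $ m * simplex_size q"
        using le ysum by (meson mult_left_mono order_trans)
      then show ?thesis
        by (intro bexI[OF _ p(2)]) (simp add: x_eq inner_add_right inner_axis mult.commute)
    next
      case False
      then have "a $ m * (\<Sum>l\<in>UNIV. y $ l) \<le> 0"
        by (intro mult_nonpos_nonneg sum_nonneg y) auto
      then show ?thesis
        using le by (intro bexI[OF _ p(1)]) (simp add: x_eq)
    qed
  qed
next
  fix B :: "(real^'n) set"
  assume "bounded B"
  then obtain M where M: "\<And>x. x \<in> B \<Longrightarrow> norm x \<le> M"
    unfolding bounded_iff by blast
  define C where "C = 2 * M + (\<Sum>l\<in>(UNIV::'n set). M) + M"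
  have bound: "\<bar>q $ i\<bar> \<le> C" if q: "simplex_vertices q \<subseteq> B" for q i
  proof -
    have in_B: "- (\<chi> l. q $ Some l) \<in> B" "- (\<chi> l. q $ Some l) + simplex_size q *\<^sub>R axis l 1 \<in> B" for l
      using q by (auto simp: simplex_vertices_def simplex_size_def Let_def)
    have M0: "M \<ge> 0"
      using M[OF in_B(1)] norm_ge_zero order_trans by blast
    have some: "\<bar>q $ Some l\<bar> \<le> M" for l
      using component_le_norm_cart[of "- (\<chi> l. q $ Some l)" l] M[OF in_B(1)] by simp
    have size: "\<bar>simplex_size q\<bar> \<le> 2 * M"
    proof -
      fix l :: 'n
      have "\<bar>simplex_size q - q $ Some l\<bar> \<le> M"
        using component_le_norm_cart[of "- (\<chi> l. q $ Some l) + simplex_size q *\<^sub>R axis l 1" l]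
          M[OF in_B(2)[of l]] by simp
      then show ?thesis
        using some[of l] by linarith
    qed
    have sum: "\<bar>\<Sum>l\<in>UNIV. q $ Some l\<bar> \<le> (\<Sum>l\<in>(UNIV::'n set). M)"
      by (intro order_trans[OF sum_abs] sum_mono some)
    show ?thesis
    proof (cases i)
      case None
      then show ?thesis
        using size sum M0 unfolding C_def simplex_size_def by simp
    next
      case (Some l)
      have "(\<Sum>l\<in>(UNIV::'n set). M) \<ge> 0"
        by (intro sum_nonneg M0)
      then have "M \<le> C"
        using M0 unfolding C_def by linarith
      with Some some[of l] show ?thesis
        by simp
    qed
  qed
  have "norm q \<le> (\<Sum>i\<in>(UNIV::('n option) set). C)" if "simplex_vertices q \<subseteq> B" for q
    by (intro order_trans[OF norm_le_l1_cart] sum_mono bound that)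
  then show "bounded {q. simplex_vertices q \<subseteq> B}"
    by (auto intro!: boundedI)
qed


section \<open>Trajectories and their costs\<close>

definition stage_cost :: "('n::finite, 'm::finite) mpc \<Rightarrow> real^'n \<Rightarrow> real^'m \<Rightarrow> real" where
  "stage_cost S x u = (wnorm (Q_wt S) (x - x_ref S))\<^sup>2 + (wnorm (R_wt S) (u - u_ref S))\<^sup>2"

definition terminal_cost :: "('n::finite, 'm::finite) mpc \<Rightarrow> real^'n \<Rightarrow> real" where
  "terminal_cost S x = (wnorm (Q_term S) (x - x_ref S))\<^sup>2"

definition traj_cost :: "('n::finite, 'm::finite) mpc \<Rightarrow> ('n, 'm) traj \<Rightarrow> real" where
  "traj_cost S z =
     terminal_cost S (fst z (horizon S)) + (\<Sum>k<horizon S. stage_cost S (fst z k) (snd z k))"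

lemma stage_cost_nonneg: "0 \<le> stage_cost S x u"
  by (simp add: stage_cost_def)

lemma terminal_cost_nonneg: "0 \<le> terminal_cost S x"
  by (simp add: terminal_cost_def)

lemma traj_cost_nonneg: "0 \<le> traj_cost S z"
  by (simp add: traj_cost_def stage_cost_nonneg terminal_cost_nonneg sum_nonneg)

lemma fst_policy_traj_0 [simp]: "fst (policy_traj f x0 \<pi>) 0 = x0"
  by (simp add: policy_traj_def)

lemma fst_policy_traj_Suc:
  "fst (policy_traj f x0 \<pi>) (Suc k)
     = f (fst (policy_traj f x0 \<pi>) k, snd (policy_traj f x0 \<pi>) k)"
  by (simp add: policy_traj_def)

lemma snd_policy_traj:
  "snd (policy_traj f x0 \<pi>) k = \<pi> k (fst (policy_traj f x0 \<pi>) k)"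
  by (simp add: policy_traj_def)

locale mpc_system =
  fixes S :: "('n::finite, 'm::finite) mpc"
  assumes compact_X: "compact (X_set S)" and convex_X: "convex (X_set S)"
    and compact_U: "compact (U_set S)" and convex_U: "convex (U_set S)"
    and pos_def_Q: "pos_def (Q_wt S)" and pos_def_R: "pos_def (R_wt S)"
    and horizon_pos: "horizon S \<ge> 1" and max_iter_pos: "max_iter S \<ge> 1"
    and terminal: "terminal_conditions S"
begin

lemma pos_def_T: "pos_def (Q_term S)"
  and gam_pos: "gam_term S > 0"
  and terminal_set_subset: "terminal_set S \<subseteq> X_set S"
  and terminal_law_in_U: "x \<in> terminal_set S \<Longrightarrow> terminal_law S x \<in> U_set S"
  using terminal by (auto simp: terminal_conditions_def)

lemma terminal_set_iff: "x \<in> terminal_set S \<longleftrightarrow> terminal_cost S x \<le> gam_term S"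
  by (simp add: terminal_set_def terminal_cost_def)

lemma terminal_cost_decrease:
  assumes "x \<in> terminal_set S"
  shows "terminal_cost S (dyn S (x, terminal_law S x)) + stage_cost S x (terminal_law S x)
    \<le> terminal_cost S x"
  using terminal assms
  by (auto simp: terminal_conditions_def terminal_cost_def stage_cost_def terminal_law_def)

lemma terminal_set_invariant:
  assumes "x \<in> terminal_set S" shows "dyn S (x, terminal_law S x) \<in> terminal_set S"
  using terminal_cost_decrease[OF assms] assms stage_cost_nonneg[of S x "terminal_law S x"]
  unfolding terminal_set_iff by linarith

lemma feasible_traj_iff:
  "feasible_traj S z \<longleftrightarrow>
     (\<forall>k<horizon S. fst z (Suc k) = dyn S (fst z k, snd z k)
        \<and> fst z k \<in> X_set S \<and> snd z k \<in> U_set S) \<and>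
     fst z (horizon S) \<in> terminal_set S"
  by (simp add: feasible_traj_def terminal_set_def)

lemma stage_cost_small:
  assumes "\<epsilon> > 0"
  obtains \<delta> where "\<delta> > 0" "\<And>x u. stage_cost S x u < \<delta> \<Longrightarrow> norm (x - x_ref S) < \<epsilon>"
proof -
  obtain a where a: "a > 0" "\<And>x. a * norm x \<le> wnorm (Q_wt S) x"
    using wnorm_ge_norm[OF pos_def_Q] by blast
  have key: "norm (x - x_ref S) < \<epsilon>" if "stage_cost S x u < (a * \<epsilon>)\<^sup>2" for x u
  proof -
    have "(wnorm (Q_wt S) (x - x_ref S))\<^sup>2 < (a * \<epsilon>)\<^sup>2"
      using that zero_le_power2[of "wnorm (R_wt S) (u - u_ref S)"]
      unfolding stage_cost_def by linarith
    then have "wnorm (Q_wt S) (x - x_ref S) < a * \<epsilon>"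
      by (rule power_less_imp_less_base) (use a(1) assms in simp)
    then have "a * norm (x - x_ref S) < a * \<epsilon>"
      using a(2)[of "x - x_ref S"] by linarith
    then show ?thesis
      using a(1) by simp
  qed
  show thesis
  proof (rule that)
    show "(a * \<epsilon>)\<^sup>2 > 0"
      using a(1) assms by simp
  qed (rule key)
qed

lemma stage_cost_zero_imp:
  assumes "stage_cost S x u \<le> 0"
  shows "x = x_ref S" "u = u_ref S"
proof -
  have "wnorm (Q_wt S) (x - x_ref S) = 0" "wnorm (R_wt S) (u - u_ref S) = 0"
    using assms unfolding stage_cost_def by (auto simp: sum_power2_le_zero_iff)
  then show "x = x_ref S" "u = u_ref S"
    using wnorm_ge_norm[OF pos_def_Q] wnorm_ge_norm[OF pos_def_R]
    by (metis eq_iff_diff_eq_0 norm_le_zero_iff mult_le_0_iff not_less)+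
qed

lemma terminal_cost_small:
  assumes "\<epsilon> > 0"
  obtains \<delta> where "\<delta> > 0" "\<And>x. norm (x - x_ref S) < \<delta> \<Longrightarrow> terminal_cost S x < \<epsilon>"
proof -
  have "isCont (terminal_cost S) (x_ref S)"
    unfolding terminal_cost_def
    by (intro continuous_on_interior[of UNIV] continuous_intros) auto
  moreover have "terminal_cost S (x_ref S) = 0"
    by (simp add: terminal_cost_def)
  ultimately obtain \<delta> where "\<delta> > 0" "\<And>x. norm (x - x_ref S) < \<delta> \<Longrightarrow> \<bar>terminal_cost S x\<bar> < \<epsilon>"
    using assms unfolding continuous_at_eps_delta dist_norm by fastforce
  then show thesis
    using that by fastforce
qed

text \<open>Each weighted norm is at most a multiple of the Euclidean one, so the cost is at most
  \<open>C \<delta>\<^sup>2\<close> within distance \<open>\<delta>\<close> of the reference.\<close>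

lemma traj_cost_small:
  assumes "\<epsilon> > 0"
  obtains \<delta> where "\<delta> > 0" "\<And>z. near_reference S \<delta> z \<Longrightarrow> traj_cost S z < \<epsilon>"
proof -
  obtain p where p: "p \<ge> 0" "\<And>x. wnorm (Q_term S) x \<le> p * norm x"
    using wnorm_le_norm by blast
  obtain q where q: "q \<ge> 0" "\<And>x. wnorm (Q_wt S) x \<le> q * norm x"
    using wnorm_le_norm by blast
  obtain r where r: "r \<ge> 0" "\<And>x. wnorm (R_wt S) x \<le> r * norm x"
    using wnorm_le_norm by blast
  define C where "C = p\<^sup>2 + real (horizon S) * (q\<^sup>2 + r\<^sup>2)"
  define \<delta> where "\<delta> = sqrt (\<epsilon> / (C + 1))"
  have C: "C \<ge> 0" by (simp add: C_def)
  have \<delta>: "\<delta> > 0" "\<delta>\<^sup>2 = \<epsilon> / (C + 1)"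
    using assms C by (simp_all add: \<delta>_def)
  have bound: "w\<^sup>2 \<le> b\<^sup>2 * \<delta>\<^sup>2" if "0 \<le> w" "w \<le> b * norm y" "b \<ge> 0" "norm y < \<delta>"
    for w b and y :: "real^'k"
  proof -
    have "w \<le> b * \<delta>"
      using that by (meson less_imp_le mult_left_mono order_trans)
    then show ?thesis
      using power_mono[of w "b * \<delta>" 2] that(1) by (simp add: power_mult_distrib)
  qed
  have "traj_cost S z < \<epsilon>" if near: "near_reference S \<delta> z" for z
  proof -
    have "terminal_cost S (fst z (horizon S)) \<le> p\<^sup>2 * \<delta>\<^sup>2"
      unfolding terminal_cost_def using near
      by (intro bound[OF wnorm_nonneg[OF pos_def_T] p(2) p(1)]) (auto simp: near_reference_def)
    moreover have "stage_cost S (fst z k) (snd z k) \<le> (q\<^sup>2 + r\<^sup>2) * \<delta>\<^sup>2" if "k < horizon S" for k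
      unfolding stage_cost_def distrib_right using near that
      by (intro add_mono bound[OF wnorm_nonneg[OF pos_def_Q] q(2) q(1)]
          bound[OF wnorm_nonneg[OF pos_def_R] r(2) r(1)]) (auto simp: near_reference_def)
    then have "(\<Sum>k<horizon S. stage_cost S (fst z k) (snd z k))
        \<le> real (horizon S) * ((q\<^sup>2 + r\<^sup>2) * \<delta>\<^sup>2)"
      using sum_bounded_above[of "{..<horizon S}" "\<lambda>k. stage_cost S (fst z k) (snd z k)"] by simp
    ultimately have "traj_cost S z \<le> C * \<delta>\<^sup>2"
      unfolding traj_cost_def C_def by (simp add: algebra_simps)
    also have "\<dots> < (C + 1) * \<delta>\<^sup>2"
      using \<delta>(1) by (simp add: distrib_right)
    also have "\<dots> = \<epsilon>"
      using C \<delta>(2) by simp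
    finally show ?thesis .
  qed
  then show thesis
    using that \<delta>(1) by blast
qed

text \<open>The shifted trajectory drops the first pair and appends one step of the terminal law, started
  in the terminal set. The appended stage cost and the new terminal cost are together at most the
  old terminal cost.\<close>

lemma feasible_shift_traj:
  fixes z :: "('n, 'm) traj"
  assumes z: "feasible_traj S z"
  defines "s \<equiv> shift_traj S (dyn S (fst z 0, snd z 0)) z"
  shows "feasible_traj S s"
    and "traj_cost S s + stage_cost S (fst z 0) (snd z 0) \<le> traj_cost S z"
proof -
  obtain M where N: "horizon S = Suc M"
    using horizon_pos by (cases "horizon S") auto
  have s_Suc: "fst s (Suc k) = dyn S (fst s k, snd s k)" for k
    unfolding s_def shift_traj_def by (rule fst_policy_traj_Suc)
  have s_u: "snd s k = (if k < M then snd z (Suc k) else terminal_law S (fst s k))" for k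
    unfolding s_def shift_traj_def snd_policy_traj by (simp add: N)
  have z_Suc: "fst z (Suc k) = dyn S (fst z k, snd z k)" if "k \<le> M" for k
    using z that unfolding feasible_traj_iff N by (auto simp: less_Suc_eq_le)
  have z_in: "fst z k \<in> X_set S \<and> snd z k \<in> U_set S" if "k \<le> M" for k
    using z that unfolding feasible_traj_iff N by (auto simp: less_Suc_eq_le)
  have s_x: "fst s k = fst z (Suc k)" if "k \<le> M" for k
    using that
  proof (induction k)
    case 0
    then show ?case by (simp add: z_Suc s_def shift_traj_def)
  next
    case (Suc k)
    then show ?case by (simp add: s_Suc s_u z_Suc)
  qed
  have last: "fst s M \<in> terminal_set S"
    using z s_x[OF order_refl] unfolding feasible_traj_iff N by metis
  have lawM: "snd s M = terminal_law S (fst s M)"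
    by (simp add: s_u)
  have "fst s k \<in> X_set S \<and> snd s k \<in> U_set S" if "k < Suc M" for k
  proof (cases "k = M")
    case True
    then show ?thesis
      using last lawM terminal_set_subset terminal_law_in_U by auto
  next
    case False
    then show ?thesis
      using that z_in[of "Suc k"] by (simp add: s_x s_u)
  qed
  then show "feasible_traj S s"
    unfolding feasible_traj_iff N using s_Suc terminal_set_invariant[OF last] lawM by auto
  have "(\<Sum>k<M. stage_cost S (fst s k) (snd s k)) = (\<Sum>k<M. stage_cost S (fst z (Suc k)) (snd z (Suc k)))"
    by (intro sum.cong) (auto simp: s_x s_u)
  moreover have "terminal_cost S (fst s (Suc M)) + stage_cost S (fst s M) (snd s M)
      \<le> terminal_cost S (fst z (Suc M))"
    using terminal_cost_decrease[OF last] by (simp add: s_Suc lawM s_x)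
  ultimately show "traj_cost S s + stage_cost S (fst z 0) (snd z 0) \<le> traj_cost S z"
    unfolding traj_cost_def N
    by (subst (2) sum.lessThan_Suc_shift) simp
qed

text \<open>The terminal inequality telescopes along the trajectory. This supplies feasible trajectories
  starting near the reference whose cost is controlled by the initial state alone.\<close>

lemma terminal_law_traj:
  fixes x0 :: "real^'n"
  assumes x0: "x0 \<in> terminal_set S"
  defines "z \<equiv> policy_traj (dyn S) x0 (\<lambda>_. terminal_law S)"
  shows "feasible_traj S z" and "traj_cost S z \<le> terminal_cost S x0"
proof -
  have z_Suc: "fst z (Suc k) = dyn S (fst z k, terminal_law S (fst z k))"
    and z_u: "snd z k = terminal_law S (fst z k)" for k
    unfolding z_def by (simp_all add: fst_policy_traj_Suc snd_policy_traj)
  have in_T: "fst z k \<in> terminal_set S" for k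
    by (induction k) (auto simp: z_Suc terminal_set_invariant x0, simp add: z_def x0)
  then show "feasible_traj S z"
    using terminal_set_subset terminal_law_in_U
    unfolding feasible_traj_iff by (auto simp: z_Suc z_u)
  have "terminal_cost S (fst z n) + (\<Sum>k<n. stage_cost S (fst z k) (snd z k)) \<le> terminal_cost S x0" for n
  proof (induction n)
    case 0
    then show ?case by (simp add: z_def)
  next
    case (Suc n)
    then show ?case
      using terminal_cost_decrease[OF in_T[of n]] by (simp add: z_Suc z_u)
  qed
  then show "traj_cost S z \<le> terminal_cost S x0"
    unfolding traj_cost_def by blast
qed

end

section \<open>One linearization step\<close>

text \<open>The constraints of one prediction step, gathered as a condition on the pair of state and input.
  As a convex set it can be transferred at once from the vertices to their convex hull.\<close>

definition stage_set ::
  "('n::finite, 'm::finite) mpc \<Rightarrow> ((real^'n) \<times> (real^'m) \<Rightarrow> real^'r) \<Rightarrow>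
   ((real^'n) \<times> (real^'m) \<Rightarrow> real^'r) \<Rightarrow> (real^'n) \<times> (real^'m) \<Rightarrow> real \<Rightarrow> real \<Rightarrow> real^'r \<Rightarrow>
   ((real^'n) \<times> (real^'m)) set" where
  "stage_set S g h z t e b =
     {(x, u). wnorm (Q_wt S) (x - x_ref S) \<le> t \<and> wnorm (R_wt S) (u - u_ref S) \<le> e \<and>
        (\<forall>i. (g (x, u) - taylor1 h z (x, u)) $ i \<le> b $ i) \<and> x \<in> X_set S \<and> u \<in> U_set S}"

lemma tube_feasible_iff:
  "tube_feasible S V g h z v q \<theta> \<eta> \<longleftrightarrow>
     (\<forall>k<horizon S. \<forall>x\<in>V (q k). (x, v k + gain S z k *v x)
        \<in> stage_set S g h (fst z k, snd z k) (\<theta> k) (\<eta> k) (q (Suc k))) \<and>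
     (\<forall>x\<in>V (q (horizon S)). wnorm (Q_term S) (x - x_ref S) \<le> \<theta> (horizon S)) \<and>
     \<theta> (horizon S) \<le> sqrt (gam_term S) \<and> (\<forall>x\<in>V (q 0). x = fst z 0)"
  by (simp add: tube_feasible_def stage_set_def Let_def)

locale tube_mpc = mpc_system S + tube_parameterization \<Gamma> V
  for S :: "('n::finite, 'm::finite) mpc"
    and \<Gamma> :: "real^'n^'r::finite" and V :: "real^'r \<Rightarrow> (real^'n) set" +
  fixes g h :: "(real^'n) \<times> (real^'m) \<Rightarrow> real^'r"
  assumes dc: "dc_form \<Gamma> (dyn S) g h"
begin

lemma dyn_component: "(\<Gamma> *v dyn S p) $ i = g p $ i - h p $ i"
  and convex_g: "convex_on UNIV (\<lambda>p. g p $ i)"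
  and convex_h: "convex_on UNIV (\<lambda>p. h p $ i)"
  and h_derivative: "(h has_derivative frechet_derivative h (at p)) (at p)"
  using dc by (simp_all add: dc_form_def frechet_derivative_works[symmetric] differentiable_on_def
      del: split_paired_All)

lemma taylor1_le: "taylor1 h p y $ i \<le> h y $ i"
proof -
  have "((\<lambda>p. h p $ i) has_derivative (\<lambda>d. frechet_derivative h (at p) d $ i)) (at p)"
    by (rule bounded_linear.has_derivative[OF bounded_linear_vec_nth h_derivative])
  from convex_on_ge_tangent[OF convex_h this, of y] show ?thesis
    by (simp add: taylor1_def)
qed

lemma taylor1_self: "taylor1 h p p = h p"
  using linear_0[OF has_derivative_linear[OF h_derivative]] by (simp add: taylor1_def)

lemma taylor1_affine:
  assumes "s + t = 1"
  shows "taylor1 h p (s *\<^sub>R x + t *\<^sub>R y) = s *\<^sub>R taylor1 h p x + t *\<^sub>R taylor1 h p y"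
proof -
  note lin = has_derivative_linear[OF h_derivative[of p]]
  have "s *\<^sub>R x + t *\<^sub>R y - p = s *\<^sub>R (x - p) + t *\<^sub>R (y - p)"
    using assms by (simp add: algebra_simps flip: scaleR_add_left)
  moreover have "h p = s *\<^sub>R h p + t *\<^sub>R h p"
    using assms by (simp flip: scaleR_add_left)
  ultimately show ?thesis
    by (simp add: taylor1_def linear_add[OF lin] linear_scale[OF lin] scaleR_add_right)
qed

lemma continuous_on_constraint: "continuous_on UNIV (\<lambda>p. (g p - taylor1 h z p) $ i)"
proof -
  have "continuous_on UNIV (\<lambda>p. frechet_derivative h (at z) (p - z))"
    by (intro bounded_linear.continuous_on[OF has_derivative_bounded_linear[OF h_derivative]]
        continuous_intros)
  then show ?thesis
    unfolding taylor1_def vector_minus_component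
    by (intro continuous_intros convex_on_continuous[OF open_UNIV convex_g])
qed

lemma convex_stage_set: "convex (stage_set S g h z t e b)"
proof -
  have "stage_set S g h z t e b =
      ({x. wnorm (Q_wt S) (x - x_ref S) \<le> t} \<times> {u. wnorm (R_wt S) (u - u_ref S) \<le> e})
      \<inter> (\<Inter>i. {p. (g p - taylor1 h z p) $ i \<le> b $ i}) \<inter> (X_set S \<times> U_set S)"
    by (auto simp: stage_set_def)
  moreover have "convex {p. (g p - taylor1 h z p) $ i \<le> b $ i}" for i
  proof (rule convexI, unfold mem_Collect_eq)
    fix x y and s t :: real
    assume x: "(g x - taylor1 h z x) $ i \<le> b $ i" and y: "(g y - taylor1 h z y) $ i \<le> b $ i"
      and st: "0 \<le> s" "0 \<le> t" "s + t = 1"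
    have "g (s *\<^sub>R x + t *\<^sub>R y) $ i \<le> s * g x $ i + t * g y $ i"
      using convex_g[of i] st unfolding convex_on_def by blast
    then have "(g (s *\<^sub>R x + t *\<^sub>R y) - taylor1 h z (s *\<^sub>R x + t *\<^sub>R y)) $ i
        \<le> s * (g x - taylor1 h z x) $ i + t * (g y - taylor1 h z y) $ i"
      by (simp add: taylor1_affine[OF st(3)] algebra_simps)
    also have "\<dots> \<le> s * b $ i + t * b $ i"
      by (intro add_mono mult_left_mono x y st)
    also have "\<dots> = b $ i"
      using st(3) by (simp flip: distrib_right)
    finally show "(g (s *\<^sub>R x + t *\<^sub>R y) - taylor1 h z (s *\<^sub>R x + t *\<^sub>R y)) $ i \<le> b $ i" .
  qed
  ultimately show ?thesis
    by (auto intro!: convex_Int convex_INT convex_Times convex_wnorm_sublevel pos_def_Q pos_def_R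
        convex_X convex_U)
qed

lemma stage_set_hull:
  assumes "\<And>x. x \<in> V b \<Longrightarrow> (x, v + K *v x) \<in> stage_set S g h z t e b'"
    and "x \<in> convex hull V b"
  shows "(x, v + K *v x) \<in> stage_set S g h z t e b'"
proof -
  have "convex {x. (x, v + K *v x) \<in> stage_set S g h z t e b'}"
  proof (rule convexI, unfold mem_Collect_eq)
    fix x y and s r :: real
    assume "(x, v + K *v x) \<in> stage_set S g h z t e b'" "(y, v + K *v y) \<in> stage_set S g h z t e b'"
      and sr: "0 \<le> s" "0 \<le> r" "s + r = 1"
    then have "s *\<^sub>R (x, v + K *v x) + r *\<^sub>R (y, v + K *v y) \<in> stage_set S g h z t e b'"
      by (intro convexD[OF convex_stage_set])
    moreover have "s *\<^sub>R (x, v + K *v x) + r *\<^sub>R (y, v + K *v y)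
        = (s *\<^sub>R x + r *\<^sub>R y, v + K *v (s *\<^sub>R x + r *\<^sub>R y))"
      using sr(3)
      by (simp add: matrix_vector_right_distrib matrix_vector_mult_scaleR algebra_simps
          flip: scaleR_add_left)
    ultimately show "(s *\<^sub>R x + r *\<^sub>R y, v + K *v (s *\<^sub>R x + r *\<^sub>R y)) \<in> stage_set S g h z t e b'"
      by simp
  qed
  then have "convex hull V b \<subseteq> {x. (x, v + K *v x) \<in> stage_set S g h z t e b'}"
    by (intro hull_minimal) (use assms(1) in auto)
  then show ?thesis
    using assms(2) by blast
qed

text \<open>The tangent inequality makes \<open>g\<close> minus the linearized \<open>h\<close> an upper bound of \<open>\<Gamma> f\<close>.\<close>

lemma stage_set_successor:
  assumes "(x, u) \<in> stage_set S g h z t e b"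
  shows "dyn S (x, u) \<in> convex hull V b"
proof (rule polytope_subset_hull)
  fix i
  have "g (x, u) $ i - taylor1 h z (x, u) $ i \<le> b $ i"
    using assms by (simp add: stage_set_def)
  then show "(\<Gamma> *v dyn S (x, u)) $ i \<le> b $ i"
    using taylor1_le[of z "(x, u)" i] by (simp add: dyn_component)
qed

text \<open>The actual states stay in the convex hulls of the vertices, where the constraints and the
  bounds \<open>\<theta>\<close> and \<open>\<eta>\<close> on the stage norms remain valid because they describe convex sets.\<close>

lemma tube_feasible_rollout:
  assumes tube: "tube_feasible S V g h z v q \<theta> \<eta>"
  defines "z' \<equiv> policy_traj (dyn S) (fst z 0) (\<lambda>k x. v k + gain S z k *v x)"
  shows "feasible_traj S z'" and "traj_cost S z' \<le> tube_objective S \<theta> \<eta>"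
proof -
  let ?N = "horizon S"
  have z'_Suc: "fst z' (Suc k) = dyn S (fst z' k, snd z' k)"
    and z'_u: "snd z' k = v k + gain S z k *v fst z' k" for k
    unfolding z'_def by (simp_all add: fst_policy_traj_Suc snd_policy_traj)
  have stage: "(fst z' k, snd z' k)
      \<in> stage_set S g h (fst z k, snd z k) (\<theta> k) (\<eta> k) (q (Suc k))"
    if "k < ?N" "fst z' k \<in> convex hull V (q k)" for k
    unfolding z'_u
  proof (rule stage_set_hull[OF _ that(2)])
    show "(x, v k + gain S z k *v x) \<in> stage_set S g h (fst z k, snd z k) (\<theta> k) (\<eta> k) (q (Suc k))"
      if "x \<in> V (q k)" for x
      using tube \<open>k < ?N\<close> that unfolding tube_feasible_iff by blast
  qed
  have hull: "fst z' k \<in> convex hull V (q k)" if "k \<le> ?N" for k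
    using that
  proof (induction k)
    case 0
    have "V (q 0) = {fst z 0}"
      using tube vertices_nonempty[of "q 0"] by (auto simp: tube_feasible_iff)
    then show ?case by (simp add: z'_def)
  next
    case (Suc k)
    then have "fst z' k \<in> convex hull V (q k)" "k < ?N"
      by simp_all
    from stage_set_successor[OF stage[OF this(2,1)]] show ?case
      unfolding z'_Suc .
  qed
  have stage': "(fst z' k, snd z' k)
      \<in> stage_set S g h (fst z k, snd z k) (\<theta> k) (\<eta> k) (q (Suc k))" if "k < ?N" for k
    using stage hull that by simp
  have "convex hull V (q ?N) \<subseteq> {x. wnorm (Q_term S) (x - x_ref S) \<le> \<theta> ?N}"
    using tube by (intro hull_minimal convex_wnorm_sublevel pos_def_T) (auto simp: tube_feasible_iff)
  then have last: "wnorm (Q_term S) (fst z' ?N - x_ref S) \<le> \<theta> ?N"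
    using hull[of ?N] by auto
  have last_sq: "terminal_cost S (fst z' ?N) \<le> (\<theta> ?N)\<^sup>2"
    unfolding terminal_cost_def by (intro power_mono last wnorm_nonneg pos_def_T)
  have "0 \<le> \<theta> ?N"
    using last wnorm_nonneg[OF pos_def_T] order_trans by blast
  then have "(\<theta> ?N)\<^sup>2 \<le> (sqrt (gam_term S))\<^sup>2"
    using tube by (intro power_mono) (auto simp: tube_feasible_iff)
  then have "fst z' ?N \<in> terminal_set S"
    using last_sq gam_pos unfolding terminal_set_iff by simp
  then show "feasible_traj S z'"
    unfolding feasible_traj_iff using stage' by (auto simp: z'_Suc stage_set_def)
  have "stage_cost S (fst z' k) (snd z' k) \<le> (\<theta> k)\<^sup>2 + (\<eta> k)\<^sup>2" if "k < ?N" for k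
    unfolding stage_cost_def using stage'[OF that]
    by (intro add_mono power_mono wnorm_nonneg pos_def_Q pos_def_R) (auto simp: stage_set_def)
  then show "traj_cost S z' \<le> tube_objective S \<theta> \<eta>"
    unfolding traj_cost_def tube_objective_def
    by (intro add_mono last_sq sum_mono) auto
qed

text \<open>A linearization is exact at its centre, so the cross sections may be the points of \<open>z\<close>.\<close>

lemma nominal_tube:
  assumes z: "feasible_traj S z"
  obtains v q \<theta> \<eta> where "tube_feasible S V g h z v q \<theta> \<eta>"
    and "tube_objective S \<theta> \<eta> = traj_cost S z"
proof
  let ?v = "\<lambda>k. snd z k - gain S z k *v fst z k"
  let ?q = "\<lambda>k. \<Gamma> *v fst z k"
  let ?\<theta> = "\<lambda>k. wnorm (if k < horizon S then Q_wt S else Q_term S) (fst z k - x_ref S)"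
  let ?\<eta> = "\<lambda>k. wnorm (R_wt S) (snd z k - u_ref S)"
  have "(g (fst z k, snd z k) - taylor1 h (fst z k, snd z k) (fst z k, snd z k)) $ i
      = (\<Gamma> *v fst z (Suc k)) $ i" if "k < horizon S" for k i
    using z that by (simp add: taylor1_self dyn_component feasible_traj_iff)
  moreover have "wnorm (Q_term S) (fst z (horizon S) - x_ref S) \<le> sqrt (gam_term S)"
    using z by (auto simp: feasible_traj_def intro: real_le_rsqrt)
  ultimately show "tube_feasible S V g h z ?v ?q ?\<theta> ?\<eta>"
    using z unfolding tube_feasible_iff
    by (auto simp: vertices_singleton stage_set_def feasible_traj_iff)
  show "tube_objective S ?\<theta> ?\<eta> = traj_cost S z"
    unfolding tube_objective_def traj_cost_def stage_cost_def terminal_cost_def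
    by (auto intro!: sum.cong)
qed

end

section \<open>Existence of minimizers\<close>

text \<open>Entries beyond the horizon occur neither in the constraints nor in the objective, so no bound
  on them follows from admissibility. Setting them to 0 restores compactness.\<close>

definition truncate_seq :: "nat \<Rightarrow> (nat \<Rightarrow> 'a::zero) \<Rightarrow> nat \<Rightarrow> 'a" where
  "truncate_seq n f k = (if k < n then f k else 0)"

lemma tube_feasible_truncate:
  "tube_feasible S V g h z (truncate_seq (horizon S) v) (truncate_seq (Suc (horizon S)) q)
     (truncate_seq (Suc (horizon S)) \<theta>) (truncate_seq (horizon S) \<eta>)
   \<longleftrightarrow> tube_feasible S V g h z v q \<theta> \<eta>"
  unfolding tube_feasible_iff by (auto simp: truncate_seq_def)

lemma tube_objective_truncate:
  "tube_objective S (truncate_seq (Suc (horizon S)) \<theta>) (truncate_seq (horizon S) \<eta>)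
   = tube_objective S \<theta> \<eta>"
  unfolding tube_objective_def by (auto simp: truncate_seq_def intro!: sum.cong)

context tube_mpc
begin

lemma closed_stage_set:
  fixes x :: "'p::topological_space \<Rightarrow> real^'n"
  assumes "continuous_on UNIV x" "continuous_on UNIV u" "continuous_on UNIV t"
    "continuous_on UNIV e" "continuous_on UNIV b"
  shows "closed {p. (x p, u p) \<in> stage_set S g h z (t p) (e p) (b p)}"
proof -
  have "{p. (x p, u p) \<in> stage_set S g h z (t p) (e p) (b p)} =
     {p. wnorm (Q_wt S) (x p - x_ref S) \<le> t p} \<inter> {p. wnorm (R_wt S) (u p - u_ref S) \<le> e p}
     \<inter> (\<Inter>i. {p. (g (x p, u p) - taylor1 h z (x p, u p)) $ i \<le> b p $ i})
     \<inter> (x -` X_set S) \<inter> (u -` U_set S)"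
    by (auto simp: stage_set_def)
  also have "closed \<dots>"
  proof -
    have "continuous_on UNIV (\<lambda>p. (g (x p, u p) - taylor1 h z (x p, u p)) $ i)" for i
      by (rule continuous_on_compose2[OF continuous_on_constraint continuous_on_Pair[OF assms(1,2)]]) simp
    then have "closed {p. (g (x p, u p) - taylor1 h z (x p, u p)) $ i \<le> b p $ i}" for i
      by (rule closed_Collect_le[OF _ continuous_on_component[OF assms(5)]])
    moreover have "closed {p. wnorm (Q_wt S) (x p - x_ref S) \<le> t p}"
      "closed {p. wnorm (R_wt S) (u p - u_ref S) \<le> e p}"
      by (intro closed_Collect_le continuous_intros assms)+
    moreover have "closed (x -` X_set S)" "closed (u -` U_set S)"
      by (intro closed_vimage compact_imp_closed compact_X compact_U assms)+
    ultimately show ?thesis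
      by (intro closed_Int closed_INT ballI)
  qed
  finally show ?thesis .
qed

lemma closed_tube_feasible:
  "closed {(v, q, \<theta>, \<eta>). tube_feasible S V g h z v q \<theta> \<eta>}"
proof -
  obtain F where F: "\<And>\<phi>. \<phi> \<in> F \<Longrightarrow> continuous_on UNIV \<phi>" "\<And>q. V q = (\<lambda>\<phi>. \<phi> q) ` F"
    using vertex_functions by blast
  let ?v = "\<lambda>p :: (nat \<Rightarrow> real^'m) \<times> (nat \<Rightarrow> real^'r) \<times> (nat \<Rightarrow> real) \<times> (nat \<Rightarrow> real). fst p"
    and ?q = "\<lambda>p :: (nat \<Rightarrow> real^'m) \<times> (nat \<Rightarrow> real^'r) \<times> (nat \<Rightarrow> real) \<times> (nat \<Rightarrow> real). fst (snd p)"
    and ?\<theta> = "\<lambda>p :: (nat \<Rightarrow> real^'m) \<times> (nat \<Rightarrow> real^'r) \<times> (nat \<Rightarrow> real) \<times> (nat \<Rightarrow> real). fst (snd (snd p))"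
    and ?\<eta> = "\<lambda>p :: (nat \<Rightarrow> real^'m) \<times> (nat \<Rightarrow> real^'r) \<times> (nat \<Rightarrow> real) \<times> (nat \<Rightarrow> real). snd (snd (snd p))"
  have coord: "continuous_on UNIV (\<lambda>p. ?v p k)" "continuous_on UNIV (\<lambda>p. ?q p k)"
    "continuous_on UNIV (\<lambda>p. ?\<theta> p k)" "continuous_on UNIV (\<lambda>p. ?\<eta> p k)" for k
    by (rule continuous_on_product_then_coordinatewise,
        intro continuous_on_fst continuous_on_snd continuous_on_id)+
  have vertex: "continuous_on UNIV (\<lambda>p. \<phi> (?q p k))" if "\<phi> \<in> F" for \<phi> k
    by (rule continuous_on_compose2[OF F(1)[OF that] coord(2)]) simp
  have "{(v, q, \<theta>, \<eta>). tube_feasible S V g h z v q \<theta> \<eta>} =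
     (\<Inter>k\<in>{k. k < horizon S}. \<Inter>\<phi>\<in>F. {p. (\<phi> (?q p k), ?v p k + gain S z k *v \<phi> (?q p k))
        \<in> stage_set S g h (fst z k, snd z k) (?\<theta> p k) (?\<eta> p k) (?q p (Suc k))}) \<inter>
     (\<Inter>\<phi>\<in>F. {p. wnorm (Q_term S) (\<phi> (?q p (horizon S)) - x_ref S) \<le> ?\<theta> p (horizon S)}) \<inter>
     {p. ?\<theta> p (horizon S) \<le> sqrt (gam_term S)} \<inter> (\<Inter>\<phi>\<in>F. {p. \<phi> (?q p 0) = fst z 0})"
    by (rule set_eqI) (simp add: case_prod_beta tube_feasible_iff F(2))
  also have "closed \<dots>"
    by (intro closed_Int closed_INT ballI closed_Collect_le closed_Collect_eq closed_stage_set
        continuous_intros coord vertex bounded_linear.continuous_on[OF matrix_vector_mul_bounded_linear])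
  finally show ?thesis .
qed

text \<open>The objective bounds \<open>\<theta>\<close> and \<open>\<eta>\<close>. The vertices lie in \<open>X\<close> or, at the end of the horizon, in the
  terminal ellipsoid, which bounds the offsets; and an input in \<open>U\<close> at some vertex bounds \<open>v\<close>.\<close>

lemma tube_optimal_exists:
  assumes z: "feasible_traj S z"
  shows "\<exists>v q \<theta> \<eta>. tube_optimal S V g h z v q \<theta> \<eta>"
proof -
  let ?N = "horizon S"
  obtain v0 q0 \<theta>0 \<eta>0 where nominal: "tube_feasible S V g h z v0 q0 \<theta>0 \<eta>0"
    and J0: "tube_objective S \<theta>0 \<eta>0 = traj_cost S z"
    by (rule nominal_tube[OF z])
  define J where "J = traj_cost S z"
  obtain bx where bx: "bx > 0" "\<And>x. x \<in> X_set S \<Longrightarrow> norm x \<le> bx"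
    using compact_imp_bounded[OF compact_X] unfolding bounded_pos by blast
  obtain bu where bu: "bu > 0" "\<And>u. u \<in> U_set S \<Longrightarrow> norm u \<le> bu"
    using compact_imp_bounded[OF compact_U] unfolding bounded_pos by blast
  obtain b1 where b1: "b1 > 0" "\<And>q. V q \<subseteq> X_set S \<Longrightarrow> norm q \<le> b1"
    using vertices_coercive[OF compact_imp_bounded[OF compact_X]] unfolding bounded_pos by blast
  obtain b2 where b2: "b2 > 0"
    "\<And>q. V q \<subseteq> {x. wnorm (Q_term S) (x - x_ref S) \<le> sqrt (gam_term S)} \<Longrightarrow> norm q \<le> b2"
    using vertices_coercive[OF bounded_wnorm_sublevel[OF pos_def_T]] unfolding bounded_pos by blast
  define \<rho> where "\<rho> k = bu + onorm ((*v) (gain S z k)) * bx" for k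
  have onorm_nonneg: "0 \<le> onorm ((*v) (gain S z k))" for k
    by (rule onorm_pos_le[OF matrix_vector_mul_bounded_linear])
  have \<rho>: "\<rho> k \<ge> 0" for k
    using bu(1) bx(1) onorm_nonneg[of k] unfolding \<rho>_def by simp
  define D where "D = {v::nat \<Rightarrow> real^'m. \<forall>k. v k \<in> cball 0 (\<rho> k)}
    \<times> {q::nat \<Rightarrow> real^'r. \<forall>k. q k \<in> cball 0 (max b1 b2)}
    \<times> {\<theta>::nat \<Rightarrow> real. \<forall>k. \<theta> k \<in> cball 0 (sqrt J)} \<times> {\<eta>::nat \<Rightarrow> real. \<forall>k. \<eta> k \<in> cball 0 (sqrt J)}"
  define E where "E = D \<inter> {(v, q, \<theta>, \<eta>). tube_feasible S V g h z v q \<theta> \<eta>}"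
  have "compact D"
    unfolding D_def by (intro compact_Times compact_Pi_UNIV compact_cball)
  then have "compact E"
    unfolding E_def by (intro compact_Int_closed closed_tube_feasible)
  have in_E: "(truncate_seq ?N v, truncate_seq (Suc ?N) q, truncate_seq (Suc ?N) \<theta>,
      truncate_seq ?N \<eta>) \<in> E"
    if tube: "tube_feasible S V g h z v q \<theta> \<eta>" and le: "tube_objective S \<theta> \<eta> \<le> J" for v q \<theta> \<eta>
  proof -
    have stage: "x \<in> X_set S \<and> v k + gain S z k *v x \<in> U_set S" if "k < ?N" "x \<in> V (q k)" for k x
      using tube that unfolding tube_feasible_iff stage_set_def by blast
    have v: "norm (v k) \<le> \<rho> k" if k: "k < ?N" for k
    proof -
      obtain x where x: "x \<in> V (q k)"
        using vertices_nonempty by blast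
      have "norm (v k) \<le> norm (v k + gain S z k *v x) + norm (gain S z k *v x)"
        by (metis add_diff_cancel_right' norm_triangle_ineq4)
      also have "\<dots> \<le> bu + onorm ((*v) (gain S z k)) * norm x"
        by (intro add_mono bu onorm[OF matrix_vector_mul_bounded_linear]) (use stage[OF k x] in simp)
      also have "\<dots> \<le> \<rho> k"
        unfolding \<rho>_def using bx(2)[of x] stage[OF k x] onorm_nonneg[of k]
        by (simp add: mult_left_mono)
      finally show ?thesis .
    qed
    have q: "norm (q k) \<le> max b1 b2" if "k \<le> ?N" for k
    proof (cases "k = ?N")
      case True
      have "V (q ?N) \<subseteq> {x. wnorm (Q_term S) (x - x_ref S) \<le> sqrt (gam_term S)}"
        using tube unfolding tube_feasible_iff by fastforce
      then show ?thesis
        using b2(2) True by (simp add: le_max_iff_disj)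
    next
      case False
      then have "V (q k) \<subseteq> X_set S"
        using stage[of k] that by auto
      then show ?thesis
        using b1(2) by (simp add: le_max_iff_disj)
    qed
    have sum_le: "(\<theta> k)\<^sup>2 + (\<eta> k)\<^sup>2 \<le> (\<Sum>k<?N. (\<theta> k)\<^sup>2 + (\<eta> k)\<^sup>2)" if "k < ?N" for k
      using that by (intro member_le_sum) auto
    have sum_nonneg: "0 \<le> (\<Sum>k<?N. (\<theta> k)\<^sup>2 + (\<eta> k)\<^sup>2)"
      by (intro sum_nonneg) auto
    have sq_le: "\<bar>y\<bar> \<le> sqrt J" if "y\<^sup>2 \<le> J" for y
      using real_sqrt_le_mono[OF that] by simp
    have \<theta>: "\<bar>\<theta> k\<bar> \<le> sqrt J" if "k \<le> ?N" for k
    proof (rule sq_le, cases "k = ?N")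
      case True
      then show "(\<theta> k)\<^sup>2 \<le> J"
        using le sum_nonneg unfolding tube_objective_def by simp
    next
      case False
      then show "(\<theta> k)\<^sup>2 \<le> J"
        using le sum_le[of k] that zero_le_power2[of "\<eta> k"] zero_le_power2[of "\<theta> ?N"]
        unfolding tube_objective_def by linarith
    qed
    have \<eta>: "\<bar>\<eta> k\<bar> \<le> sqrt J" if "k < ?N" for k
      using le sum_le[OF that] zero_le_power2[of "\<theta> k"] zero_le_power2[of "\<theta> ?N"]
      unfolding tube_objective_def by (intro sq_le) linarith
    have "max b1 b2 \<ge> 0"
      using b1(1) by simp
    moreover have "sqrt J \<ge> 0"
      using traj_cost_nonneg[of S z] by (simp add: J_def)
    ultimately show ?thesis
      unfolding E_def D_def using tube v q \<theta> \<eta> \<rho>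
      by (simp add: tube_feasible_truncate) (simp add: truncate_seq_def less_Suc_eq_le)
  qed
  have E_nonempty: "E \<noteq> {}"
    using in_E[OF nominal] J0 by (auto simp: J_def)
  have coord: "continuous_on E (\<lambda>p. fst (snd (snd p)) k)" "continuous_on E (\<lambda>p. snd (snd (snd p)) k)" for k
    by (rule continuous_on_product_then_coordinatewise,
        intro continuous_on_fst continuous_on_snd continuous_on_id)+
  have "continuous_on E (\<lambda>p. tube_objective S (fst (snd (snd p))) (snd (snd (snd p))))"
    unfolding tube_objective_def
    by (intro continuous_on_add continuous_on_sum continuous_on_power coord)
  from continuous_attains_inf[OF \<open>compact E\<close> E_nonempty this]
  obtain p where p: "p \<in> E" "\<And>p'. p' \<in> E \<Longrightarrow> tube_objective S (fst (snd (snd p))) (snd (snd (snd p)))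
      \<le> tube_objective S (fst (snd (snd p'))) (snd (snd (snd p')))"
    by blast
  obtain v q \<theta> \<eta> where "p = (v, q, \<theta>, \<eta>)"
    by (cases p) auto
  then have opt: "(v, q, \<theta>, \<eta>) \<in> E"
    "\<And>v' q' \<theta>' \<eta>'. (v', q', \<theta>', \<eta>') \<in> E \<Longrightarrow> tube_objective S \<theta> \<eta> \<le> tube_objective S \<theta>' \<eta>'"
    using p(1) p(2)[of "(_, _, _, _)"] by simp_all
  have below: "tube_objective S \<theta> \<eta> \<le> tube_objective S \<theta>' \<eta>'"
    if "tube_feasible S V g h z v' q' \<theta>' \<eta>'" "tube_objective S \<theta>' \<eta>' \<le> J" for v' q' \<theta>' \<eta>'
    using opt(2)[OF in_E[OF that]] by (simp add: tube_objective_truncate)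
  have "tube_objective S \<theta> \<eta> \<le> J"
    using below[OF nominal] J0 by (simp add: J_def)
  then have "tube_objective S \<theta> \<eta> \<le> tube_objective S \<theta>' \<eta>'"
    if "tube_feasible S V g h z v' q' \<theta>' \<eta>'" for v' q' \<theta>' \<eta>'
    using below[OF that] by linarith
  moreover have "tube_feasible S V g h z v q \<theta> \<eta>"
    using opt(1) by (simp add: E_def)
  ultimately show ?thesis
    unfolding tube_optimal_def by blast
qed

section \<open>The closed loop\<close>

lemma sl_iteration_exists:
  assumes "feasible_traj S z" shows "\<exists>J z'. sl_iteration S V g h z J z'"
  using tube_optimal_exists[OF assms] unfolding sl_iteration_def by blast

lemma sl_iteration_decrease:
  assumes z: "feasible_traj S z" and iter: "sl_iteration S V g h z J z'"
  shows "feasible_traj S z' \<and> fst z' 0 = fst z 0 \<and> traj_cost S z' \<le> traj_cost S z"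
proof -
  obtain v q \<theta> \<eta> where opt: "tube_optimal S V g h z v q \<theta> \<eta>"
    and z': "z' = policy_traj (dyn S) (fst z 0) (\<lambda>k x. v k + gain S z k *v x)"
    using iter unfolding sl_iteration_def by blast
  have tube: "tube_feasible S V g h z v q \<theta> \<eta>"
    using opt by (simp add: tube_optimal_def)
  obtain v0 q0 \<theta>0 \<eta>0 where "tube_feasible S V g h z v0 q0 \<theta>0 \<eta>0"
    "tube_objective S \<theta>0 \<eta>0 = traj_cost S z"
    by (rule nominal_tube[OF z])
  then have "tube_objective S \<theta> \<eta> \<le> traj_cost S z"
    using opt unfolding tube_optimal_def by metis
  then show ?thesis
    using tube_feasible_rollout[OF tube] unfolding z' by simp
qed

lemma visited_feasible:
  assumes "visited S V g h z0 z" and "feasible_traj S z0"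
  shows "feasible_traj S z"
  using assms by (induction rule: visited.induct) (auto dest: sl_iteration_decrease intro: feasible_shift_traj)

lemma well_defined: "closed_loop_well_defined S V g h"
  unfolding closed_loop_well_defined_def using visited_feasible tube_optimal_exists by blast

lemma step2_decrease:
  assumes z: "feasible_traj S z" and step: "step2 S V g h z z'"
  shows "feasible_traj S z' \<and> fst z' 0 = fst z 0 \<and> traj_cost S z' \<le> traj_cost S z"
proof -
  obtain T J l where T: "T 0 = z" "T (Suc l) = z'"
    "\<And>j. j \<le> l \<Longrightarrow> sl_iteration S V g h (T j) (J j) (T (Suc j))"
    using step unfolding step2_def by blast
  have "feasible_traj S (T j) \<and> fst (T j) 0 = fst z 0 \<and> traj_cost S (T j) \<le> traj_cost S z"
    if "j \<le> Suc l" for j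
    using that
  proof (induction j)
    case 0
    then show ?case using z T(1) by simp
  next
    case (Suc j)
    then show ?case
      using sl_iteration_decrease[OF _ T(3)[of j]] by fastforce
  qed
  then show ?thesis
    using T(2) by blast
qed

text \<open>Iterating forever is possible, and \<open>max_iter\<close> bounds the first index at which the stopping test
  holds.\<close>

lemma step2_exists:
  assumes z: "feasible_traj S z" shows "\<exists>z'. step2 S V g h z z'"
proof -
  have "\<exists>T. \<forall>n. (feasible_traj S (T n) \<and> (n = 0 \<longrightarrow> T n = z))
      \<and> (\<exists>J. sl_iteration S V g h (T n) J (T (Suc n)))"
  proof (rule dependent_nat_choice)
    show "\<exists>y. feasible_traj S y \<and> (0 = 0 \<longrightarrow> y = z)" for n :: nat
      using z by blast
    show "\<exists>y. (feasible_traj S y \<and> (Suc n = 0 \<longrightarrow> y = z)) \<and> (\<exists>J. sl_iteration S V g h x J y)"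
      if "feasible_traj S x \<and> (n = 0 \<longrightarrow> x = z)" for x n
      using sl_iteration_exists sl_iteration_decrease that by blast
  qed
  then obtain T where T: "T 0 = z" "\<And>n. \<exists>J. sl_iteration S V g h (T n) J (T (Suc n))"
    by blast
  then obtain J where J: "\<And>n. sl_iteration S V g h (T n) (J n) (T (Suc n))"
    by metis
  define l where "l = (LEAST j. stops S J j)"
  have "stops S J (max_iter S - 1)"
    using max_iter_pos by (simp add: stops_def)
  then have "stops S J l" "\<forall>j<l. \<not> stops S J j"
    unfolding l_def using LeastI not_less_Least by fast+
  then show ?thesis
    unfolding step2_def using T(1) J by blast
qed

section \<open>Convergence and stability\<close>

lemma run_decrease:
  assumes "closed_loop_run S V g h z0 x u"
  obtains z where "z 0 = z0" and "\<And>n. fst (z n) 0 = x n"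
    and "\<And>n. traj_cost S (z (Suc n)) + stage_cost S (x n) (u n) \<le> traj_cost S (z n)"
proof -
  obtain z w where run: "feasible_traj S z0" "fst z0 0 = x 0" "z 0 = z0"
    "\<And>n. step2 S V g h (z n) (w n)" "\<And>n. u n = snd (w n) 0"
    "\<And>n. x (Suc n) = dyn S (x n, u n)" "\<And>n. z (Suc n) = shift_traj S (x (Suc n)) (w n)"
    using assms unfolding closed_loop_run_def by blast
  have inv: "feasible_traj S (z n) \<and> fst (z n) 0 = x n" for n
  proof (induction n)
    case 0
    then show ?case using run by simp
  next
    case (Suc n)
    then show ?case
      using step2_decrease[OF _ run(4)[of n]] feasible_shift_traj(1)[of "w n"] run(5,6,7)[of n]
      by (simp add: shift_traj_def)
  qed
  have "traj_cost S (z (Suc n)) + stage_cost S (x n) (u n) \<le> traj_cost S (z n)" for n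
    using inv[of n] step2_decrease[OF _ run(4)[of n]] feasible_shift_traj(2)[of "w n"] run(5,6,7)[of n]
    by fastforce
  with run(3) inv show thesis
    using that by blast
qed

lemma run_cost_sum:
  assumes "closed_loop_run S V g h z0 x u"
  shows "(\<Sum>i<n. stage_cost S (x i) (u i)) \<le> traj_cost S z0"
proof -
  obtain z where z: "z 0 = z0"
    "\<And>n. traj_cost S (z (Suc n)) + stage_cost S (x n) (u n) \<le> traj_cost S (z n)"
    by (rule run_decrease[OF assms]) blast
  have "(\<Sum>i<n. stage_cost S (x i) (u i)) + traj_cost S (z n) \<le> traj_cost S z0"
  proof (induction n)
    case 0
    then show ?case using z(1) by simp
  next
    case (Suc n)
    then show ?case using z(2)[of n] by simp
  qed
  then show ?thesis
    using traj_cost_nonneg[of S "z n"] by linarith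
qed

lemma run_stage_cost_le:
  assumes "closed_loop_run S V g h z0 x u"
  shows "stage_cost S (x n) (u n) \<le> traj_cost S z0"
proof -
  have "0 \<le> (\<Sum>i<n. stage_cost S (x i) (u i))"
    by (intro sum_nonneg stage_cost_nonneg)
  then show ?thesis
    using run_cost_sum[OF assms, of "Suc n"] by simp
qed

lemma run_converges:
  assumes "closed_loop_run S V g h z0 x u"
  shows "x \<longlonglongrightarrow> x_ref S"
proof -
  have "summable (\<lambda>n. stage_cost S (x n) (u n))"
    by (rule summableI_nonneg_bounded[OF stage_cost_nonneg run_cost_sum[OF assms]])
  then have lim: "(\<lambda>n. stage_cost S (x n) (u n)) \<longlonglongrightarrow> 0"
    by (rule summable_LIMSEQ_zero)
  show ?thesis
  proof (rule LIMSEQ_I)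
    fix \<epsilon> :: real assume "\<epsilon> > 0"
    then obtain \<delta> where \<delta>: "\<delta> > 0" "\<And>x u. stage_cost S x u < \<delta> \<Longrightarrow> norm (x - x_ref S) < \<epsilon>"
      using stage_cost_small by blast
    obtain n0 where "\<And>n. n \<ge> n0 \<Longrightarrow> \<bar>stage_cost S (x n) (u n)\<bar> < \<delta>"
      using LIMSEQ_D[OF lim \<delta>(1)] by auto
    then show "\<exists>n0. \<forall>n\<ge>n0. norm (x n - x_ref S) < \<epsilon>"
      using \<delta>(2) by (meson abs_ge_self le_less_trans)
  qed
qed

lemma run_exists:
  assumes z0: "feasible_traj S z0"
  shows "\<exists>x u. closed_loop_run S V g h z0 x u"
proof -
  let ?P = "\<lambda>n y. feasible_traj S (fst y) \<and> step2 S V g h (fst y) (snd y) \<and> (n = 0 \<longrightarrow> fst y = z0)"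
  let ?next = "\<lambda>w. shift_traj S (dyn S (fst w 0, snd w 0)) w"
  have "\<exists>Y. \<forall>n. ?P n (Y n) \<and> fst (Y (Suc n)) = ?next (snd (Y n))"
  proof (rule dependent_nat_choice)
    show "\<exists>y. ?P 0 y"
    proof -
      obtain w where "step2 S V g h z0 w"
        using step2_exists[OF z0] by blast
      then show ?thesis
        using z0 by (intro exI[of _ "(z0, w)"]) simp
    qed
    show "\<exists>y'. ?P (Suc n) y' \<and> fst y' = ?next (snd y)" if "?P n y" for y n
    proof -
      have next_feasible: "feasible_traj S (?next (snd y))"
        using that step2_decrease feasible_shift_traj(1) by blast
      then obtain w where "step2 S V g h (?next (snd y)) w"
        using step2_exists by blast
      with next_feasible show ?thesis
        by (intro exI[of _ "(?next (snd y), w)"]) simp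
    qed
  qed
  then obtain Y where Y: "\<And>n. ?P n (Y n)" "\<And>n. fst (Y (Suc n)) = ?next (snd (Y n))"
    by blast
  define x u where "x n = fst (fst (Y n)) 0" and "u n = snd (snd (Y n)) 0" for n
  have w0: "fst (snd (Y n)) 0 = x n" for n
    using Y(1)[of n] step2_decrease unfolding x_def by blast
  have x_Suc: "x (Suc n) = dyn S (x n, u n)" for n
    using w0[of n] by (simp add: x_def[of "Suc n"] u_def Y(2) shift_traj_def)
  have "fst (Y (Suc n)) = shift_traj S (x (Suc n)) (snd (Y n))" for n
    unfolding Y(2) x_Suc w0 u_def ..
  then have "closed_loop_run S V g h z0 x u"
    unfolding closed_loop_run_def using Y(1) z0 x_Suc
    by (intro conjI exI[of _ "\<lambda>n. fst (Y n)"] exI[of _ "\<lambda>n. snd (Y n)"] allI)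
      (auto simp: x_def u_def)
  then show ?thesis by blast
qed

lemma reference_terminal: "x_ref S \<in> terminal_set S"
  using gam_pos by (simp add: terminal_set_def)

lemma terminal_law_reference: "terminal_law S (x_ref S) = u_ref S"
  by (simp add: terminal_law_def)

lemma dyn_reference: "dyn S (x_ref S, u_ref S) = x_ref S"
proof -
  have "terminal_cost S (dyn S (x_ref S, u_ref S)) \<le> 0"
    using terminal_cost_decrease[OF reference_terminal]
    by (simp add: terminal_law_reference terminal_cost_def stage_cost_def)
  then have "wnorm (Q_term S) (dyn S (x_ref S, u_ref S) - x_ref S) = 0"
    by (simp add: terminal_cost_def)
  moreover obtain a where "a > 0" "\<And>x. a * norm x \<le> wnorm (Q_term S) x"
    using wnorm_ge_norm[OF pos_def_T] by blast
  ultimately have "norm (dyn S (x_ref S, u_ref S) - x_ref S) \<le> 0"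
    by (metis mult_le_0_iff not_less)
  then show ?thesis by simp
qed

text \<open>The constant trajectory at the reference has cost 0, hence so has every stage of its runs.\<close>

lemma equilibrium: "closed_loop_equilibrium S V g h"
proof -
  let ?z = "(\<lambda>_. x_ref S, \<lambda>_. u_ref S) :: ('n, 'm) traj"
  have "feasible_traj S ?z"
    using reference_terminal terminal_set_subset terminal_law_in_U[OF reference_terminal]
    by (auto simp: feasible_traj_iff dyn_reference terminal_law_reference)
  moreover have "traj_cost S ?z = 0"
    by (simp add: traj_cost_def terminal_cost_def stage_cost_def)
  then have "x n = x_ref S \<and> u n = u_ref S" if "closed_loop_run S V g h ?z x u" for x u n
    using run_stage_cost_le[OF that, of n] stage_cost_zero_imp by simp
  ultimately show ?thesis
    unfolding closed_loop_equilibrium_def using dyn_reference by blast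
qed

text \<open>A stage cost never exceeds the cost of the initial trajectory, and a small stage cost keeps the
  state near the reference. It remains to make the initial cost small: by closeness of the whole
  trajectory, or by choosing the one generated by the terminal law.\<close>

lemma stable: "lyapunov_stable S V g h"
  unfolding lyapunov_stable_def
proof (intro conjI allI impI)
  fix \<epsilon> :: real assume "\<epsilon> > 0"
  then obtain c where c: "c > 0" "\<And>x u. stage_cost S x u < c \<Longrightarrow> norm (x - x_ref S) < \<epsilon>"
    using stage_cost_small by blast
  have run_near: "norm (x n - x_ref S) < \<epsilon>"
    if "traj_cost S z0 < c" "closed_loop_run S V g h z0 x u" for z0 x u n
    using c(2) run_stage_cost_le[OF that(2), of n] that(1) by (meson le_less_trans)
  obtain \<delta> where \<delta>: "\<delta> > 0" "\<And>z :: ('n, 'm) traj. near_reference S \<delta> z \<Longrightarrow> traj_cost S z < c"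
    using traj_cost_small[OF c(1)] by blast
  then show "\<exists>\<delta>>0. \<forall>z0 x u. near_reference S \<delta> z0 \<and> closed_loop_run S V g h z0 x u \<longrightarrow>
      (\<forall>n. norm (x n - x_ref S) < \<epsilon>)"
    using run_near by blast
  have "min c (gam_term S) > 0"
    using c(1) gam_pos by simp
  then obtain d where d: "d > 0"
    "\<And>x. norm (x - x_ref S) < d \<Longrightarrow> terminal_cost S x < min c (gam_term S)"
    using terminal_cost_small by blast
  show "\<exists>\<delta>>0. \<forall>x0. norm (x0 - x_ref S) < \<delta> \<longrightarrow>
      (\<exists>z0. feasible_traj S z0 \<and> fst z0 0 = x0 \<and>
        (\<forall>x u. closed_loop_run S V g h z0 x u \<longrightarrow> (\<forall>n. norm (x n - x_ref S) < \<epsilon>)))"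
  proof (intro exI[of _ d] conjI allI impI d(1))
    fix x0 assume "norm (x0 - x_ref S) < d"
    then have x0: "terminal_cost S x0 < c" "x0 \<in> terminal_set S"
      using d(2)[of x0] by (auto simp: terminal_set_iff)
    show "\<exists>z0. feasible_traj S z0 \<and> fst z0 0 = x0 \<and>
        (\<forall>x u. closed_loop_run S V g h z0 x u \<longrightarrow> (\<forall>n. norm (x n - x_ref S) < \<epsilon>))"
      using terminal_law_traj[OF x0(2)] x0(1) run_near
      by (intro exI[of _ "policy_traj (dyn S) x0 (\<lambda>_. terminal_law S)"])
        (meson fst_policy_traj_0 le_less_trans)
  qed
qed

lemma attractive: "locally_attractive S V g h"
  unfolding locally_attractive_def using run_converges zero_less_one by blast

lemma region_eq: "region_of_attraction S V g h = feasible_states S"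
proof
  show "region_of_attraction S V g h \<subseteq> feasible_states S"
    by (auto simp: region_of_attraction_def feasible_states_def closed_loop_run_def)
  show "feasible_states S \<subseteq> region_of_attraction S V g h"
  proof
    fix x0 assume "x0 \<in> feasible_states S"
    then obtain z0 where "feasible_traj S z0" "fst z0 0 = x0"
      by (auto simp: feasible_states_def)
    then obtain x u where "closed_loop_run S V g h z0 x u"
      using run_exists by blast
    moreover from this have "x 0 = x0"
      using \<open>fst z0 0 = x0\<close> by (simp add: closed_loop_run_def)
    ultimately show "x0 \<in> region_of_attraction S V g h"
      unfolding region_of_attraction_def using run_converges by blast
  qed
qed

lemma closed_loop_properties:
  "closed_loop_well_defined S V g h \<and> asymptotically_stable S V g h
    \<and> region_of_attraction S V g h = feasible_states S"
  using well_defined equilibrium stable attractive region_eq by (simp add: asymptotically_stable_def)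

end

theorem theorem5:
  fixes S :: "('n::finite, 'm::finite) mpc"
    and gb hb :: "(real^'n) \<times> (real^'m) \<Rightarrow> real^('n + 'n)"
    and gs hs :: "(real^'n) \<times> (real^'m) \<Rightarrow> real^('n option)"
  assumes "dyn S differentiable_on UNIV"
    and "compact (X_set S)" and "convex (X_set S)"
    and "compact (U_set S)" and "convex (U_set S)"
    and "pos_def (Q_wt S)" and "pos_def (R_wt S)"
    and "horizon S \<ge> 1" and "max_iter S \<ge> 1"
    and "terminal_conditions S"
  shows
    "(dc_form box_Gamma (dyn S) gb hb \<longrightarrow>
        closed_loop_well_defined S box_vertices gb hb \<and>
        asymptotically_stable S box_vertices gb hb \<and>
        region_of_attraction S box_vertices gb hb = feasible_states S) \<and>
     (dc_form simplex_Gamma (dyn S) gs hs \<longrightarrow>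
        closed_loop_well_defined S simplex_vertices gs hs \<and>
        asymptotically_stable S simplex_vertices gs hs \<and>
        region_of_attraction S simplex_vertices gs hs = feasible_states S)"
proof -
  interpret mpc_system S
    using assms by unfold_locales
  have "tube_mpc S \<Gamma> V g h" if "tube_parameterization \<Gamma> V" "dc_form \<Gamma> (dyn S) g h"
    for \<Gamma> :: "real^'n^'r" and V g h
    using that mpc_system_axioms by (simp add: tube_mpc_def tube_mpc_axioms_def)
  note closed_loop = tube_mpc.closed_loop_properties[OF this]
  show ?thesis
    using closed_loop[OF box_parameterization] closed_loop[OF simplex_parameterization] by blast
qed

end
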